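(* Let $N \geq 2$ be an integer and let $\frac{N}{2} < p \leq N$. If $\frac{N}{2} < p < N$, assume $f \in L^p(\mathbb{R}^N)$, while if $p = N$ assume $f \in L^N(\mathbb{R}^N) \cap L^q(\mathbb{R}^N)$ for some $1 < q < N$. Then $u = \tilde{I}_2 f$ is a distributional solution of Poisson's equation, i.e. $$-\int_{\mathbb{R}^N} u\, \Delta \varphi = \int_{\mathbb{R}^N} f \varphi \qquad \text{for all } \varphi \in C_c^\infty(\mathbb{R}^N),$$ and has the following regularity estimates for all $x, z \in \mathbb{R}^N$: i) If $\frac{N}{2} < p < N$, then $$|u(x) - u(z)| \leq C|x-z|^{2-\frac{N}{p}} \|f\|_{L^p(\mathbb{R}^N)}$$ with a constant $C = C(p, N)$ independent of $f$, $x$, $z$. ii) If $p = N$, then $$|u(x) - u(z)| \leq C|x-z| \,\bigl(|\ln|x-z|| + 1\bigr)^{\frac{1}{N'}} \left( \|f\|_{L^N(\mathbb{R}^N)} + \|f\|_{L^q(\mathbb{R}^N)} \right)$$ with a constant $C = C(q, N)$ independent of $f$, $x$, $z$.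
   Context: Here $N' = \frac{N}{N-1}$, and when $x=z$ the right-hand side of the inequality in ii) is understood as $0$. The operator $\tilde{I}_2$ is defined as follows. If $N \geq 3$, it is the modified Riesz potential of order $2$, $$\tilde{I}_2 f(x) := \gamma(N, 2) \int_{\mathbb{R}^N} f(y) \left[\frac{1}{|x-y|^{N-2}} - \frac{1}{|y|^{N-2}}\right] dy, \qquad \gamma(N,2) = \frac{\Gamma(\frac{N-2}{2})}{4\pi^{\frac{N}{2}}}.$$ If $N = 2$, it is the modified logarithmic potential $$\tilde{I}_2 f(x) := \frac{1}{2\pi} \int_{\mathbb{R}^2} \left[\log \frac{1}{|x - y|} - \log \frac{1}{|y|}\right] f(y) \, dy.$$ *)

theory Defs
  imports "HOL-Analysis.Analysis"
begin

(* Functions, not classes modulo null sets; p is a finite exponent. *)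

definition Lp :: "real \<Rightarrow> ('a::euclidean_space \<Rightarrow> real) set" where
  "Lp p = {f. f \<in> borel_measurable lebesgue \<and> integrable lebesgue (\<lambda>y. \<bar>f y\<bar> powr p)}"

definition Lp_norm :: "real \<Rightarrow> ('a::euclidean_space \<Rightarrow> real) \<Rightarrow> real" where
  "Lp_norm p f = (\<integral>y. \<bar>f y\<bar> powr p \<partial>lebesgue) powr (1 / p)"

definition locally_integrable :: "('a::euclidean_space \<Rightarrow> real) \<Rightarrow> bool" where
  "locally_integrable f \<longleftrightarrow> (\<forall>K. compact K \<longrightarrow> set_integrable lebesgue K f)"

definition partial_deriv :: "'a::euclidean_space \<Rightarrow> ('a \<Rightarrow> real) \<Rightarrow> 'a \<Rightarrow> real" where
  "partial_deriv b f x = frechet_derivative f (at x) b"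

primrec Ck :: "nat \<Rightarrow> ('a::euclidean_space \<Rightarrow> real) \<Rightarrow> bool" where
  "Ck 0 f \<longleftrightarrow> continuous_on UNIV f"
| "Ck (Suc k) f \<longleftrightarrow>
     (\<forall>x. f differentiable (at x)) \<and> (\<forall>b\<in>Basis. Ck k (partial_deriv b f))"

definition test_function :: "('a::euclidean_space \<Rightarrow> real) \<Rightarrow> bool" where
  "test_function \<phi> \<longleftrightarrow> (\<forall>k. Ck k \<phi>) \<and> compact (closure {x. \<phi> x \<noteq> 0})"

definition laplacian :: "('a::euclidean_space \<Rightarrow> real) \<Rightarrow> 'a \<Rightarrow> real" where
  "laplacian \<phi> x = (\<Sum>b\<in>Basis. partial_deriv b (partial_deriv b \<phi>) x)"

(* Local integrability of u and f is what makes both integrals below meaningful;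
   the Bochner integral of a non-integrable function would silently be 0. *)

definition distributional_poisson_solution ::
    "('a::euclidean_space \<Rightarrow> real) \<Rightarrow> ('a \<Rightarrow> real) \<Rightarrow> bool" where
  "distributional_poisson_solution u f \<longleftrightarrow>
     locally_integrable u \<and> locally_integrable f \<and>
     (\<forall>\<phi>. test_function \<phi> \<longrightarrow>
        - (\<integral>x. u x * laplacian \<phi> x \<partial>lebesgue) = (\<integral>x. f x * \<phi> x \<partial>lebesgue))"

definition riesz_const :: "nat \<Rightarrow> real" where
  "riesz_const N = Gamma ((real N - 2) / 2) / (4 * pi powr (real N / 2))"

(* Division by zero and ln 0 give 0 in the integrands below; this affects only the
   null set of y in {0, x}. *)

definition riesz_integrand :: "(real^'n \<Rightarrow> real) \<Rightarrow> real^'n \<Rightarrow> real^'n \<Rightarrow> real" where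
  "riesz_integrand f x y =
     f y * (1 / norm (x - y) ^ (CARD('n) - 2) - 1 / norm y ^ (CARD('n) - 2))"

definition log_integrand :: "(real^'n \<Rightarrow> real) \<Rightarrow> real^'n \<Rightarrow> real^'n \<Rightarrow> real" where
  "log_integrand f x y = (ln (1 / norm (x - y)) - ln (1 / norm y)) * f y"

(* The intended dimensions are CARD('n) >= 2; in dimension 1 the value is irrelevant. *)

definition I2_tilde :: "(real^'n \<Rightarrow> real) \<Rightarrow> real^'n \<Rightarrow> real" where
  "I2_tilde f x =
     (if CARD('n) = 2
      then 1 / (2 * pi) * (\<integral>y. log_integrand f x y \<partial>lebesgue)
      else riesz_const CARD('n) * (\<integral>y. riesz_integrand f x y \<partial>lebesgue))"

definition I2_tilde_defined :: "(real^'n \<Rightarrow> real) \<Rightarrow> real^'n \<Rightarrow> bool" where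
  "I2_tilde_defined f x \<longleftrightarrow>
     (if CARD('n) = 2 then integrable lebesgue (log_integrand f x)
      else integrable lebesgue (riesz_integrand f x))"

end

(* In polar form N r^(N-1) dr, Hoelder's inequality reduces the regularity estimates to a
   pointwise bound on the kernel difference: with h = |x - z| and k the Newton kernel,
   |k(x-y) - k(z-y)| is at most a multiple of Phi(|x-y|) + Phi(|z-y|), where
   Phi(r) = h^theta r^-(N-2+theta) for r <= 2h plus h r^-(N-1) for r >= h.
   For p < N both parts lie in the dual space with norm a multiple of h^(2-N/p). For p = N the second
   part just fails to be in the dual space: on h <= r <= max(1,h) it produces the logarithm, and
   beyond that it is paired with the L^q norm.
   Poisson's equation follows by Fubini from k * Laplacian(phi) = -const * phi, which is
   Green's identity for the kernels k((|x|^2 + e)^(1/2)) in the limit e -> 0: their Laplacians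
   form an approximate identity whose total mass is an explicit radial integral. *)
theory Submission
  imports Defs
begin

text \<open>The potential cannot be split at the minus sign: for p > N/2 the function f need not be
  integrable against k(x - y) at infinity, so only differences of kernels are paired with f.
  Subtracting k(-y) costs nothing in Poisson's equation, because the Laplacian of a test function
  has integral zero. Logarithm and power are treated together: both satisfy k'(r) = -c r^(1-N), with
  c = 1 or c = N - 2. Pairing k with the Laplacian then produces the constant c N omega, where omega
  is the volume of the unit ball; it is 2 pi in the plane and the reciprocal of
  \<open>riesz_const\<close> otherwise. The estimates are bounds on nonnegative integrals, so each
  of them also proves that the potential exists. Integrals over the completed measure are moved to
  \<open>lborel\<close> through a Borel representative of f, since Fubini is applied to the Borel
  product measure.\<close>

section \<open>Radial integrals\<close>

text \<open>The half-lines {..r} generate the Borel sets, and both measures give them the volume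
  omega r^N of a ball; for the density this is the fundamental theorem of calculus. Polar
  coordinates are thus available without a surface measure on spheres.\<close>

lemma distr_norm_lborel:
  "distr lborel borel (norm :: 'a::euclidean_space \<Rightarrow> real) =
     density lborel (\<lambda>r. ennreal (real DIM('a) * unit_ball_vol DIM('a) * r ^ (DIM('a) - 1)) * indicator {0..} r)"
    (is "?M = ?D")
proof (rule measure_eqI_generator_eq[where \<Omega> = UNIV and E = "range atMost" and A = "\<lambda>i. {..real i}"])
  have vol: "emeasure ?M {..r} = (if r < 0 then 0 else ennreal (unit_ball_vol DIM('a) * r ^ DIM('a)))" for r
  proof -
    have "emeasure ?M {..r} = emeasure lborel (cball (0::'a) r)"
      by (subst emeasure_distr) (auto simp: cball_def vimage_def)
    also have "\<dots> = (if r < 0 then 0 else ennreal (unit_ball_vol DIM('a) * r ^ DIM('a)))"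
      by (simp add: emeasure_cball)
    finally show ?thesis .
  qed
  have dens: "emeasure ?D {..r} = (if r < 0 then 0 else ennreal (unit_ball_vol DIM('a) * r ^ DIM('a)))" for r
  proof -
    let ?f = "\<lambda>t. real DIM('a) * unit_ball_vol DIM('a) * t ^ (DIM('a) - 1)"
    have "emeasure ?D {..r} = (\<integral>\<^sup>+ t. ennreal (?f t) * indicator {0..r} t \<partial>lborel)"
      by (subst emeasure_density) (auto intro!: nn_integral_cong split: split_indicator)
    also have "\<dots> = (if r < 0 then 0 else ennreal (unit_ball_vol DIM('a) * r ^ DIM('a)))"
    proof (cases "r < 0")
      case False
      then have "(\<integral>\<^sup>+ t. ennreal (?f t) * indicator {0..r} t \<partial>lborel)
        = unit_ball_vol DIM('a) * r ^ DIM('a) - unit_ball_vol DIM('a) * 0 ^ DIM('a)"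
        by (intro nn_integral_FTC_Icc) (auto intro!: derivative_eq_intros)
      with False show ?thesis by (simp add: zero_power)
    qed simp
    finally show ?thesis .
  qed
  show "emeasure ?M X = emeasure ?D X" if "X \<in> range atMost" for X
    using that vol dens by auto
  show "emeasure ?M {..real i} \<noteq> \<infinity>" for i by (simp add: vol)
  show "sets ?M = sigma_sets UNIV (range atMost)"
    by (subst borel_eq_atMost) simp
  show "sets ?D = sigma_sets UNIV (range atMost)"
    by (simp, subst borel_eq_atMost, simp)
  show "Int_stable (range (atMost :: real \<Rightarrow> _))"
    by (auto simp: Int_stable_def)
  show "(\<Union>i. {..real i}) = UNIV"
    by (auto simp: real_arch_simple)
qed auto

lemma nn_integral_radial:
  assumes [measurable]: "g \<in> borel_measurable borel"
  shows "(\<integral>\<^sup>+ x. g (norm x) \<partial>(lborel :: 'a::euclidean_space measure)) =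
    (\<integral>\<^sup>+ r. ennreal (real DIM('a) * unit_ball_vol DIM('a) * r ^ (DIM('a) - 1)) * indicator {0..} r * g r \<partial>lborel)"
proof -
  have "(\<integral>\<^sup>+ x. g (norm (x::'a)) \<partial>lborel) = (\<integral>\<^sup>+ r. g r \<partial>distr lborel borel (norm :: 'a \<Rightarrow> real))"
    by (subst nn_integral_distr) auto
  then show ?thesis
    unfolding distr_norm_lborel by (simp add: nn_integral_density)
qed

lemma powr_times_power_pred:
  fixes r s :: real
  assumes "r > 0" "N > 0"
  shows "r ^ (N - 1) * r powr (- s) = r powr (real N - 1 - s)"
  using assms by (simp add: powr_realpow[symmetric] powr_add[symmetric] of_nat_diff)

text \<open>The set \<open>A\<close> of admissible radii is arbitrary, so that a ball, the exterior
  of a ball and an annulus each reduce to one elementary integral on the line.\<close>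

lemma nn_integral_norm_powr:
  assumes I: "((\<lambda>r. r powr (real DIM('a::euclidean_space) - 1 - s)) has_integral I) A"
    and A: "A \<in> sets borel" "A \<subseteq> {0..}"
  shows "(\<integral>\<^sup>+ x. ennreal (norm x powr (- s)) * indicator A (norm x) \<partial>(lborel :: 'a measure)) =
     ennreal (real DIM('a) * unit_ball_vol DIM('a) * I)"
proof -
  let ?h = "\<lambda>r. r powr (real DIM('a) - 1 - s) * indicator A r"
  have "(?h has_integral I) UNIV"
  proof -
    have "?h = (\<lambda>r. if r \<in> A then r powr (real DIM('a) - 1 - s) else 0)"
      by auto
    then show ?thesis using I by (simp add: has_integral_restrict_UNIV)
  qed
  then have h: "(\<integral>\<^sup>+ r. ennreal (?h r) \<partial>lborel) = ennreal I"
    using A by (intro nn_integral_has_integral_lborel) auto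
  have "(\<integral>\<^sup>+ x. ennreal (norm x powr (- s)) * indicator A (norm x) \<partial>(lborel :: 'a measure))
    = (\<integral>\<^sup>+ r. ennreal (real DIM('a) * unit_ball_vol DIM('a) * r ^ (DIM('a) - 1)) * indicator {0..} r
          * (ennreal (r powr (- s)) * indicator A r) \<partial>lborel)"
    using A by (intro nn_integral_radial) auto
  also have "\<dots> = (\<integral>\<^sup>+ r. ennreal (real DIM('a) * unit_ball_vol DIM('a)) * ennreal (?h r) \<partial>lborel)"
  proof (rule nn_integral_cong_AE)
    show "AE r in lborel. ennreal (real DIM('a) * unit_ball_vol DIM('a) * r ^ (DIM('a) - 1)) * indicator {0..} r
          * (ennreal (r powr (- s)) * indicator A r) =
        ennreal (real DIM('a) * unit_ball_vol DIM('a)) * ennreal (?h r)"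
      using AE_lborel_singleton[of "0::real"]
    proof eventually_elim
      case (elim r)
      show ?case
      proof (cases "r \<in> A")
        case True
        with A elim have "r > 0" by force
        then show ?thesis
          using True powr_times_power_pred[of r "DIM('a)" s]
          by (simp add: ennreal_mult[symmetric] mult.assoc)
      qed simp
    qed
  qed
  also have "\<dots> = ennreal (real DIM('a) * unit_ball_vol DIM('a)) * ennreal I"
    using A by (subst nn_integral_cmult) (auto simp: h)
  also have "\<dots> = ennreal (real DIM('a) * unit_ball_vol DIM('a) * I)"
    using h by (simp add: ennreal_mult'[symmetric])
  finally show ?thesis .
qed

lemma nn_integral_norm_powr_less:
  assumes "s < real DIM('a::euclidean_space)" "R \<ge> 0"
  shows "(\<integral>\<^sup>+ x. ennreal (norm x powr (- s)) * indicator {0..R} (norm x) \<partial>(lborel :: 'a measure)) =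
     ennreal (real DIM('a) * unit_ball_vol DIM('a) * (R powr (real DIM('a) - s) / (real DIM('a) - s)))"
  using has_integral_powr_from_0[of "real DIM('a) - 1 - s" R] assms
  by (intro nn_integral_norm_powr) (auto simp: algebra_simps)

lemma nn_integral_norm_powr_greater:
  assumes "s > real DIM('a::euclidean_space)" "R > 0"
  shows "(\<integral>\<^sup>+ x. ennreal (norm x powr (- s)) * indicator {R..} (norm x) \<partial>(lborel :: 'a measure)) =
     ennreal (real DIM('a) * unit_ball_vol DIM('a) * (R powr (real DIM('a) - s) / (s - real DIM('a))))"
proof (rule nn_integral_norm_powr)
  have "- (R powr (real DIM('a) - 1 - s + 1)) / (real DIM('a) - 1 - s + 1) =
      R powr (real DIM('a) - s) / (s - real DIM('a))"
    using assms by (simp add: field_simps)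
  then show "((\<lambda>r. r powr (real DIM('a) - 1 - s)) has_integral
      R powr (real DIM('a) - s) / (s - real DIM('a))) {R..}"
    using has_integral_powr_to_inf[of "real DIM('a) - 1 - s" R] assms by (simp add: algebra_simps)
qed (use assms in auto)

lemma nn_integral_norm_powr_log:
  assumes "0 < h" "h \<le> R"
  shows "(\<integral>\<^sup>+ x. ennreal (norm x powr (- real DIM('a))) * indicator {h..R} (norm x)
      \<partial>(lborel :: 'a::euclidean_space measure)) =
     ennreal (real DIM('a) * unit_ball_vol DIM('a) * (ln R - ln h))"
proof (rule nn_integral_norm_powr)
  have "((\<lambda>r. r powr (- 1)) has_integral ln R - ln h) {h..R}"
    using assms
    by (intro fundamental_theorem_of_calculus)
       (auto intro!: derivative_eq_intros simp: powr_minus_divide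
          simp flip: has_real_derivative_iff_has_vector_derivative)
  then show "((\<lambda>r. r powr (real DIM('a) - 1 - real DIM('a))) has_integral ln R - ln h) {h..R}"
    by simp
qed (use assms in auto)

text \<open>The radial density has the primitive omega (r^2 / (1 + r^2))^(N/2), which rises from 0
  to omega. This value is the mass of the approximate identity used for Poisson's equation.\<close>

lemma nn_integral_inverse_quadratic_power:
  "(\<integral>\<^sup>+ x. ennreal ((1 + (norm x)\<^sup>2) powr (- (real DIM('a) / 2 + 1))) \<partial>(lborel :: 'a::euclidean_space measure)) =
     ennreal (unit_ball_vol DIM('a))"
proof -
  let ?N = "DIM('a)"
  let ?w = "unit_ball_vol ?N"
  let ?F = "\<lambda>r::real. ?w * (r ^ ?N * (1 + r\<^sup>2) powr (- real ?N / 2))"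
  let ?f = "\<lambda>r::real. ?N * ?w * r ^ (?N - 1) * (1 + r\<^sup>2) powr (- (real ?N / 2 + 1))"
  have pos: "1 + r\<^sup>2 > 0" for r :: real by (simp add: add_pos_nonneg)
  have "(\<integral>\<^sup>+ x. ennreal ((1 + (norm x)\<^sup>2) powr (- (real ?N / 2 + 1))) \<partial>(lborel :: 'a measure)) =
    (\<integral>\<^sup>+ r. ennreal (?N * ?w * r ^ (?N - 1)) * indicator {0..} r * ennreal ((1 + r\<^sup>2) powr (- (real ?N / 2 + 1))) \<partial>lborel)"
    by (rule nn_integral_radial) measurable
  also have "\<dots> = (\<integral>\<^sup>+ r. ennreal (?f r) * indicator {0..} r \<partial>lborel)"
    by (intro nn_integral_cong) (auto simp: ennreal_mult[symmetric] split: split_indicator)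
  also have "\<dots> = ?w * 1 - ?F 0"
  proof (rule nn_integral_FTC_atLeast)
    show "?f \<in> borel_measurable borel" by measurable
    show "0 \<le> ?f x" if "0 \<le> x" for x using that by auto
    show "(?F has_real_derivative ?f x) (at x)" if "0 \<le> x" for x
    proof -
      have e1: "(1 + x\<^sup>2) powr (- real ?N / 2) = (1 + x\<^sup>2) * (1 + x\<^sup>2) powr (- (real ?N / 2 + 1))"
        using pos[of x] powr_add[of "1 + x\<^sup>2" 1 "- (real ?N / 2 + 1)"] by simp
      have e2: "(1 + x\<^sup>2) powr (- real ?N / 2 - 1) = (1 + x\<^sup>2) powr (- (real ?N / 2 + 1))" by simp
      have "((\<lambda>r. (1 + r\<^sup>2) powr (- real ?N / 2)) has_real_derivative
          - real ?N / 2 * (1 + x\<^sup>2) powr (- real ?N / 2 - 1) * (2 * x)) (at x)"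
        using pos[of x] by (auto intro!: derivative_eq_intros simp: power2_eq_square)
      then have "((\<lambda>r. (1 + r\<^sup>2) powr (- real ?N / 2)) has_real_derivative
          - real ?N * x * (1 + x\<^sup>2) powr (- (real ?N / 2 + 1))) (at x)"
        by (simp add: e2 mult_ac)
      from DERIV_cmult[OF DERIV_mult[OF DERIV_pow[of ?N x UNIV] this], of ?w]
      have "(?F has_real_derivative ?w * (real ?N * x ^ (?N - 1) * (1 + x\<^sup>2) powr (- real ?N / 2)
          + - real ?N * x * (1 + x\<^sup>2) powr (- (real ?N / 2 + 1)) * x ^ ?N)) (at x)"
        by simp
      moreover have "x ^ ?N = x * x ^ (?N - 1)"
        by (metis DIM_positive power_eq_if less_numeral_extra(3))
      ultimately show ?thesis
        unfolding e1 by (simp add: algebra_simps power2_eq_square)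
    qed
    have "((\<lambda>r::real. 1 - inverse (1 + r\<^sup>2)) \<longlongrightarrow> 1 - 0) at_top"
      by (intro tendsto_diff tendsto_const tendsto_inverse_0_at_top
          filterlim_tendsto_add_at_top[OF tendsto_const] filterlim_pow_at_top filterlim_ident) simp
    moreover have "1 - inverse (1 + r\<^sup>2) = r\<^sup>2 / (1 + r\<^sup>2)" for r :: real
      by (simp add: field_simps add_pos_nonneg add_nonneg_eq_0_iff)
    ultimately have lim: "((\<lambda>r::real. r\<^sup>2 / (1 + r\<^sup>2)) \<longlongrightarrow> 1) at_top"
      by simp
    have "((\<lambda>r::real. (r\<^sup>2 / (1 + r\<^sup>2)) powr (real ?N / 2)) \<longlongrightarrow> 1 powr (real ?N / 2)) at_top"
      using lim by (intro tendsto_powr tendsto_const) auto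
    moreover have "eventually (\<lambda>r::real. (r\<^sup>2 / (1 + r\<^sup>2)) powr (real ?N / 2)
         = r ^ ?N * (1 + r\<^sup>2) powr (- real ?N / 2)) at_top"
      using eventually_gt_at_top[of 0]
    proof eventually_elim
      case (elim r)
      then have "r ^ ?N = (r\<^sup>2) powr (real ?N / 2)"
        by (simp add: powr_powr powr_realpow flip: powr_numeral)
      then show ?case
        using elim pos[of r] by (simp add: powr_divide powr_minus_divide powr_realpow)
    qed
    ultimately have "((\<lambda>r::real. r ^ ?N * (1 + r\<^sup>2) powr (- real ?N / 2)) \<longlongrightarrow> 1) at_top"
      by (subst (asm) tendsto_cong) auto
    then show "(?F \<longlongrightarrow> ?w * 1) at_top"
      by (intro tendsto_mult tendsto_const)
  qed
  finally show ?thesis by (simp add: zero_power)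
qed

section \<open>Hoelder's inequality\<close>

text \<open>Young's inequality is applied to \<open>f\<close> and \<open>g\<close> divided by the
  norms that \<open>A\<close> and \<open>B\<close> stand for. A zero bound cannot be normalised, but
  it makes the product vanish almost everywhere. Bounds in place of norms spare every integrability
  hypothesis.\<close>

lemma nn_integral_Holder:
  fixes f g :: "'a \<Rightarrow> real"
  assumes [measurable]: "f \<in> borel_measurable M" "g \<in> borel_measurable M"
    and nonneg: "\<And>x. f x \<ge> 0" "\<And>x. g x \<ge> 0"
    and pq: "p > 1" "q > 1" "1 / p + 1 / q = 1"
    and f: "(\<integral>\<^sup>+ x. ennreal (f x powr p) \<partial>M) \<le> ennreal A" and A: "A \<ge> 0"
    and g: "(\<integral>\<^sup>+ x. ennreal (g x powr q) \<partial>M) \<le> ennreal B" and B: "B \<ge> 0"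
  shows "(\<integral>\<^sup>+ x. ennreal (f x * g x) \<partial>M) \<le> ennreal (A powr (1 / p) * B powr (1 / q))"
proof -
  consider "A = 0" | "B = 0" | "A > 0" "B > 0" using A B by linarith
  then show ?thesis
  proof cases
    case 1
    with f have "AE x in M. f x powr p = 0"
      by (simp add: nn_integral_0_iff_AE)
    then have "AE x in M. f x * g x = 0" by (auto elim!: eventually_mono)
    then have "(\<integral>\<^sup>+ x. ennreal (f x * g x) \<partial>M) = 0"
      by (subst nn_integral_0_iff_AE) (auto elim!: eventually_mono)
    then show ?thesis by simp
  next
    case 2
    with g have "AE x in M. g x powr q = 0"
      by (simp add: nn_integral_0_iff_AE)
    then have "AE x in M. f x * g x = 0" by (auto elim!: eventually_mono)
    then have "(\<integral>\<^sup>+ x. ennreal (f x * g x) \<partial>M) = 0"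
      by (subst nn_integral_0_iff_AE) (auto elim!: eventually_mono)
    then show ?thesis by simp
  next
    case 3
    define \<alpha> where "\<alpha> = A powr (1 / p)"
    define \<beta> where "\<beta> = B powr (1 / q)"
    have pos: "\<alpha> > 0" "\<beta> > 0" using 3 by (auto simp: \<alpha>_def \<beta>_def)
    have pw: "\<alpha> powr p = A" "\<beta> powr q = B"
      using 3 pq by (auto simp: \<alpha>_def \<beta>_def powr_powr)
    have young: "f x * g x \<le> \<alpha> * \<beta> / (p * A) * f x powr p + \<alpha> * \<beta> / (q * B) * g x powr q" for x
    proof -
      have "(f x / \<alpha>) * (g x / \<beta>) \<le> (f x / \<alpha>) powr p / p + (g x / \<beta>) powr q / q"
        using pq nonneg pos by (intro Youngs_inequality) auto
      also have "\<dots> = f x powr p / (p * A) + g x powr q / (q * B)"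
        using nonneg pos by (simp add: powr_divide pw mult.commute)
      finally show ?thesis using pos by (simp add: field_simps)
    qed
    have "(\<integral>\<^sup>+ x. ennreal (f x * g x) \<partial>M) \<le>
      (\<integral>\<^sup>+ x. ennreal (\<alpha> * \<beta> / (p * A)) * ennreal (f x powr p) + ennreal (\<alpha> * \<beta> / (q * B)) * ennreal (g x powr q) \<partial>M)"
    proof (intro nn_integral_mono)
      fix x
      have "ennreal (f x * g x) \<le> ennreal (\<alpha> * \<beta> / (p * A) * f x powr p + \<alpha> * \<beta> / (q * B) * g x powr q)"
        by (intro ennreal_leI young)
      also have "\<dots> = ennreal (\<alpha> * \<beta> / (p * A)) * ennreal (f x powr p) + ennreal (\<alpha> * \<beta> / (q * B)) * ennreal (g x powr q)"
        using pos pq 3 by (subst ennreal_plus) (auto simp: ennreal_mult[symmetric])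
      finally show "ennreal (f x * g x) \<le> \<dots>" .
    qed
    also have "\<dots> = ennreal (\<alpha> * \<beta> / (p * A)) * (\<integral>\<^sup>+ x. ennreal (f x powr p) \<partial>M)
        + ennreal (\<alpha> * \<beta> / (q * B)) * (\<integral>\<^sup>+ x. ennreal (g x powr q) \<partial>M)"
      by (subst nn_integral_add) (auto simp: nn_integral_cmult)
    also have "\<dots> \<le> ennreal (\<alpha> * \<beta> / (p * A)) * ennreal A + ennreal (\<alpha> * \<beta> / (q * B)) * ennreal B"
      by (intro add_mono mult_left_mono f g) auto
    also have "\<dots> = ennreal (\<alpha> * \<beta> * (1 / p + 1 / q))"
      using pos pq 3
      by (simp add: ennreal_mult[symmetric] ennreal_plus[symmetric] field_simps del: ennreal_plus)
    finally show ?thesis by (simp add: pq \<alpha>_def \<beta>_def)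
  qed
qed

text \<open>On [0,1] every t is at most its power with exponent \<open>\<theta>\<close>; this is
  applied to the two fractions of x + y, which sum to 1.\<close>

lemma powr_subadditive:
  fixes x y :: real
  assumes "x \<ge> 0" "y \<ge> 0" "0 < \<theta>" "\<theta> \<le> 1"
  shows "(x + y) powr \<theta> \<le> x powr \<theta> + y powr \<theta>"
proof (cases "x + y = 0")
  case False
  then have s: "x + y > 0" using assms by auto
  have le: "t \<le> t powr \<theta>" if "0 \<le> t" "t \<le> 1" for t :: real
    using that assms powr_mono'[of \<theta> 1 t] by (cases "t = 0") auto
  have "1 = x / (x + y) + y / (x + y)" using s by (simp add: add_divide_distrib[symmetric])
  also have "\<dots> \<le> (x / (x + y)) powr \<theta> + (y / (x + y)) powr \<theta>"
    using assms s by (intro add_mono le) auto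
  also have "\<dots> = (x powr \<theta> + y powr \<theta>) / (x + y) powr \<theta>"
    using assms s by (simp add: powr_divide add_divide_distrib)
  finally show ?thesis using s by (simp add: field_simps)
qed (use assms in auto)

section \<open>The Newton kernel\<close>

text \<open>The profile is a function of \<open>s = \<bar>w\<bar>\<^sup>2\<close>, so that \<open>s = \<bar>w\<bar>\<^sup>2 + e\<close> regularises it. At \<open>s = 0\<close> its junk value is \<open>0\<close>, as for the integrands in the definition of \<open>I2_tilde\<close>.\<close>

definition newton_profile :: "nat \<Rightarrow> real \<Rightarrow> real" where
  "newton_profile N s = (if N = 2 then - ln s / 2 else s powr (- (real N - 2) / 2))"

text \<open>The factor c in k'(r) = -c r^(1-N). Since it covers the logarithm as well, the kernel
  estimates and Green's identity need no case distinction on the dimension.\<close>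

definition newton_const :: "nat \<Rightarrow> real" where
  "newton_const N = (if N = 2 then 1 else real N - 2)"

definition newton_kernel :: "'a::euclidean_space \<Rightarrow> real" where
  "newton_kernel w = newton_profile DIM('a) ((norm w)\<^sup>2)"

lemma newton_const_pos: "N \<ge> 2 \<Longrightarrow> newton_const N > 0"
  by (auto simp: newton_const_def)

lemma DERIV_newton_profile:
  assumes "s > 0"
  shows "(newton_profile N has_real_derivative - (newton_const N / 2) * s powr (- real N / 2)) (at s)"
proof (cases "N = 2")
  case True
  have "((\<lambda>s. - ln s / 2) has_real_derivative - (1 / 2) * s powr (- 1)) (at s)"
    using assms by (auto intro!: derivative_eq_intros simp: powr_minus_divide)
  with True show ?thesis by (simp add: newton_profile_def[abs_def] newton_const_def)
next
  case False
  have "((\<lambda>s. s powr (- (real N - 2) / 2)) has_real_derivative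
      (- (real N - 2) / 2) * s powr (- (real N - 2) / 2 - 1)) (at s)"
    using assms by (intro has_real_derivative_powr)
  moreover have "- (real N - 2) / 2 - 1 = - real N / 2" by (simp add: field_simps)
  moreover have "(- (real N - 2) / 2) = - (newton_const N / 2)"
    using False by (simp add: newton_const_def field_simps)
  moreover have "newton_profile N = (\<lambda>s. s powr (- (real N - 2) / 2))"
    using False by (simp add: newton_profile_def[abs_def])
  ultimately show ?thesis by metis
qed

lemma DERIV_newton_profile_square:
  assumes "r > 0"
  shows "((\<lambda>r. newton_profile N (r\<^sup>2)) has_real_derivative - newton_const N * r powr (1 - real N)) (at r)"
proof -
  have "((\<lambda>r. newton_profile N (r\<^sup>2)) has_real_derivative
      (- (newton_const N / 2) * (r\<^sup>2) powr (- real N / 2)) * (2 * r)) (at r)"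
    using assms by (intro DERIV_chain2[OF DERIV_newton_profile]) (auto intro!: derivative_eq_intros)
  moreover have "(r\<^sup>2) powr (- real N / 2) = r powr (- real N)"
    using assms by (simp add: powr_powr flip: powr_numeral)
  moreover have "r powr (1 - real N) = r * r powr (- real N)"
    using assms powr_add[of r 1 "- real N"] by simp
  ultimately show ?thesis by (simp add: mult_ac)
qed

text \<open>The derivative \<open>- c r\<^bsup>1-N\<^esup>\<close> is split as \<open>r\<^bsup>\<theta>-1\<^esup> r\<^bsup>2-N-\<theta>\<^esup>\<close>, and the second factor is frozen at the left end point.\<close>

lemma newton_profile_diff_le:
  assumes "0 < a" "a \<le> b" "0 < \<theta>" "\<theta> \<le> 1" "N \<ge> 2"
  shows "\<bar>newton_profile N (a\<^sup>2) - newton_profile N (b\<^sup>2)\<bar>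
    \<le> newton_const N / \<theta> * (b - a) powr \<theta> * a powr (- (real N - 2 + \<theta>))"
proof -
  let ?k = "\<lambda>r. newton_profile N (r\<^sup>2)" and ?c = "newton_const N"
  let ?G = "\<lambda>r. ?c / \<theta> * a powr (- (real N - 2 + \<theta>)) * r powr \<theta>"
  have c: "?c > 0" using assms newton_const_pos by auto
  have "?k b \<le> ?k a"
  proof (rule DERIV_nonpos_imp_nonincreasing[OF \<open>a \<le> b\<close>])
    fix r assume "a \<le> r" "r \<le> b"
    then have "(?k has_real_derivative - ?c * r powr (1 - real N)) (at r)"
      using assms by (intro DERIV_newton_profile_square) auto
    moreover have "- ?c * r powr (1 - real N) \<le> 0" using c by simp
    ultimately show "\<exists>y. (?k has_real_derivative y) (at r) \<and> y \<le> 0" by blast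
  qed
  moreover have "?k a + ?G a \<le> ?k b + ?G b"
  proof (rule DERIV_nonneg_imp_nondecreasing[OF \<open>a \<le> b\<close>])
    fix r assume r: "a \<le> r" "r \<le> b"
    with assms have "r > 0" by auto
    have "((\<lambda>r. ?k r + ?G r) has_real_derivative
        - ?c * r powr (1 - real N) + ?c / \<theta> * a powr (- (real N - 2 + \<theta>)) * (\<theta> * r powr (\<theta> - 1))) (at r)"
      using \<open>r > 0\<close> by (intro DERIV_add DERIV_newton_profile_square DERIV_cmult has_real_derivative_powr)
    moreover have "r powr (1 - real N) = r powr (- (real N - 2 + \<theta>)) * r powr (\<theta> - 1)"
      using \<open>r > 0\<close> by (simp flip: powr_add)
    moreover have "r powr (- (real N - 2 + \<theta>)) \<le> a powr (- (real N - 2 + \<theta>))"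
      using assms r by (intro powr_mono2') auto
    then have "?c * (r powr (- (real N - 2 + \<theta>)) * r powr (\<theta> - 1)) \<le> ?c * (a powr (- (real N - 2 + \<theta>)) * r powr (\<theta> - 1))"
      using c by (intro mult_left_mono mult_right_mono) auto
    ultimately show "\<exists>y. ((\<lambda>r. ?k r + ?G r) has_real_derivative y) (at r) \<and> 0 \<le> y"
      using \<open>\<theta> > 0\<close> by (intro exI[of _ "- ?c * r powr (1 - real N) + ?c / \<theta> * a powr (- (real N - 2 + \<theta>)) * (\<theta> * r powr (\<theta> - 1))"])
        (simp add: mult_ac)
  qed
  ultimately have "\<bar>?k a - ?k b\<bar> \<le> ?c / \<theta> * a powr (- (real N - 2 + \<theta>)) * (b powr \<theta> - a powr \<theta>)"
    by (simp add: algebra_simps diff_divide_distrib)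
  also have "\<dots> \<le> ?c / \<theta> * a powr (- (real N - 2 + \<theta>)) * (b - a) powr \<theta>"
    using powr_subadditive[of a "b - a" \<theta>] assms c by (intro mult_left_mono) auto
  finally show ?thesis by (simp add: mult_ac)
qed

text \<open>A gain of h to the power \<open>\<theta>\<close> is paid for by a singularity of order N
  - 2 + \<open>\<theta>\<close>. It lies in the dual of L^p near the pole only if
  \<open>\<theta>\<close> < 2 - N/p, and for p at most N this excludes the mean value bound
  \<open>\<theta>\<close> = 1; hence the free parameter.\<close>

definition near_bound :: "nat \<Rightarrow> real \<Rightarrow> real \<Rightarrow> real \<Rightarrow> real" where
  "near_bound N \<theta> h r = h powr \<theta> * (r powr (- (real N - 2 + \<theta>)) * indicator {0..2 * h} r)"

definition far_bound :: "nat \<Rightarrow> real \<Rightarrow> real \<Rightarrow> real" where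
  "far_bound N h r = h * (r powr (- (real N - 1)) * indicator {h..} r)"

lemma near_bound_nonneg: "near_bound N \<theta> h r \<ge> 0"
  by (auto simp: near_bound_def)

lemma far_bound_nonneg: "h \<ge> 0 \<Longrightarrow> far_bound N h r \<ge> 0"
  by (auto simp: far_bound_def split: split_indicator)

lemma measurable_near_bound [measurable]: "near_bound N \<theta> h \<in> borel_measurable borel"
  unfolding near_bound_def[abs_def] by measurable

lemma measurable_far_bound [measurable]: "far_bound N h \<in> borel_measurable borel"
  unfolding far_bound_def[abs_def] by measurable

text \<open>Only the smaller radius a matters, and the right-hand side is symmetric. If a < h, the
  singularity is tamed with exponent \<open>\<theta>\<close>; otherwise exponent 1 gives the far
  term. Dividing by \<open>\<theta>\<close>, which is at most 1, gives both cases the same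
  constant.\<close>

lemma newton_profile_diff_near_far:
  assumes ab: "0 < a" "0 < b" "\<bar>a - b\<bar> \<le> h" and \<theta>: "0 < \<theta>" "\<theta> \<le> 1" and N: "N \<ge> 2"
  shows "\<bar>newton_profile N (a\<^sup>2) - newton_profile N (b\<^sup>2)\<bar>
    \<le> newton_const N / \<theta> * ((near_bound N \<theta> h a + far_bound N h a) + (near_bound N \<theta> h b + far_bound N h b))"
  using ab
proof (induction a b rule: linorder_wlog)
  case (le a b)
  have c: "newton_const N > 0" and "h \<ge> 0" using le N newton_const_pos by auto
  show ?case
  proof (cases "a < h")
    case True
    have "\<bar>newton_profile N (a\<^sup>2) - newton_profile N (b\<^sup>2)\<bar>
        \<le> newton_const N / \<theta> * (b - a) powr \<theta> * a powr (- (real N - 2 + \<theta>))"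
      using le \<theta> N by (intro newton_profile_diff_le) auto
    also have "\<dots> \<le> newton_const N / \<theta> * h powr \<theta> * a powr (- (real N - 2 + \<theta>))"
      using le \<theta> c by (intro mult_right_mono mult_left_mono powr_mono2) auto
    also have "\<dots> = newton_const N / \<theta> * near_bound N \<theta> h a"
      using True le by (simp add: near_bound_def)
    also have "\<dots> \<le> newton_const N / \<theta> * ((near_bound N \<theta> h a + far_bound N h a) + (near_bound N \<theta> h b + far_bound N h b))"
      using c \<theta> near_bound_nonneg[of N \<theta> h b] far_bound_nonneg[OF \<open>h \<ge> 0\<close>, of N a] far_bound_nonneg[OF \<open>h \<ge> 0\<close>, of N b]
      by (intro mult_left_mono) auto
    finally show ?thesis .
  next
    case False
    have "\<bar>newton_profile N (a\<^sup>2) - newton_profile N (b\<^sup>2)\<bar>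
        \<le> newton_const N / 1 * (b - a) powr 1 * a powr (- (real N - 2 + 1))"
      using le N by (intro newton_profile_diff_le) auto
    also have "\<dots> \<le> newton_const N / 1 * h powr 1 * a powr (- (real N - 2 + 1))"
      using le c by (intro mult_right_mono mult_left_mono powr_mono2) auto
    also have "\<dots> = newton_const N / 1 * far_bound N h a"
      using False le by (simp add: far_bound_def algebra_simps)
    also have "\<dots> \<le> newton_const N / \<theta> * far_bound N h a"
      using \<theta> c far_bound_nonneg[OF \<open>h \<ge> 0\<close>, of N a] by (intro mult_right_mono divide_left_mono) auto
    also have "\<dots> \<le> newton_const N / \<theta> * ((near_bound N \<theta> h a + far_bound N h a) + (near_bound N \<theta> h b + far_bound N h b))"
      using c \<theta> near_bound_nonneg[of N \<theta> h b] near_bound_nonneg[of N \<theta> h a] far_bound_nonneg[OF \<open>h \<ge> 0\<close>, of N b]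
      by (intro mult_left_mono) auto
    finally show ?thesis .
  qed
next
  case (sym a b)
  then show ?case by (simp add: abs_minus_commute add.commute)
qed

section \<open>Modulus of continuity of potentials\<close>

lemma distr_lborel_reflect:
  "distr lborel borel (\<lambda>y. x - y) = (lborel :: 'a::euclidean_space measure)"
  using lborel_affine[of "-1" x] by (simp add: density_1)

lemma nn_integral_lborel_reflect:
  assumes [measurable]: "g \<in> borel_measurable borel"
  shows "(\<integral>\<^sup>+ y. g (x - y) \<partial>lborel) = (\<integral>\<^sup>+ y. g (y :: 'a::euclidean_space) \<partial>lborel)"
  by (subst (2) distr_lborel_reflect[of x, symmetric]) (simp add: nn_integral_distr)

lemma measurable_newton_profile [measurable]: "newton_profile N \<in> borel_measurable borel"
  unfolding newton_profile_def[abs_def] by measurable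

lemma measurable_newton_kernel [measurable]: "newton_kernel \<in> borel_measurable borel"
  unfolding newton_kernel_def[abs_def] by measurable

lemma nn_integral_potential_Holder:
  fixes f :: "'a::euclidean_space \<Rightarrow> real" and \<Psi> :: "real \<Rightarrow> real"
  assumes [measurable]: "f \<in> borel_measurable borel" "\<Psi> \<in> borel_measurable borel"
    and \<Psi>: "\<And>r. \<Psi> r \<ge> 0"
    and pq: "p > 1" "q > 1" "1 / p + 1 / q = 1"
    and f: "(\<integral>\<^sup>+ y. ennreal (\<bar>f y\<bar> powr p) \<partial>lborel) \<le> ennreal A" and A: "A \<ge> 0"
    and B: "(\<integral>\<^sup>+ y. ennreal (\<Psi> (norm (y::'a)) powr q) \<partial>lborel) \<le> ennreal B" "B \<ge> 0"
  shows "(\<integral>\<^sup>+ y. ennreal (\<bar>f y\<bar> * \<Psi> (norm (x - y))) \<partial>lborel) \<le> ennreal (A powr (1 / p) * B powr (1 / q))"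
proof (rule nn_integral_Holder[OF _ _ _ _ pq f A _ B(2)])
  show "(\<integral>\<^sup>+ y. ennreal (\<Psi> (norm (x - y)) powr q) \<partial>lborel) \<le> ennreal B"
    using B(1) by (subst nn_integral_lborel_reflect[where g = "\<lambda>y. ennreal (\<Psi> (norm y) powr q)"]) auto
qed (use \<Psi> in auto)

lemma nn_integral_scaled_powr_indicator:
  assumes h: "h \<ge> 0" and q: "q > 0" and A: "A \<in> sets borel"
  shows "(\<integral>\<^sup>+ y. ennreal ((h * (norm y powr (- s) * indicator A (norm y))) powr q) \<partial>(lborel :: 'a measure)) =
    ennreal (h powr q) * (\<integral>\<^sup>+ y. ennreal (norm y powr (- (s * q))) * indicator A (norm y) \<partial>(lborel :: 'a::euclidean_space measure))"
proof -
  have "(\<integral>\<^sup>+ y. ennreal ((h * (norm y powr (- s) * indicator A (norm y))) powr q) \<partial>(lborel :: 'a measure)) =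
     (\<integral>\<^sup>+ y. ennreal (h powr q) * (ennreal (norm y powr (- (s * q))) * indicator A (norm y)) \<partial>(lborel :: 'a measure))"
    using h q by (intro nn_integral_cong)
      (auto simp: powr_mult powr_powr ennreal_mult split: split_indicator)
  then show ?thesis using A by (simp add: nn_integral_cmult)
qed

text \<open>The parameter \<open>\<theta>\<close> disappears from the power of h: the factor
  h^(theta q) in front cancels against the radius 2h of the ball. This homogeneity makes the near
  part scale correctly for any admissible \<open>\<theta>\<close>.\<close>

lemma nn_integral_near_bound:
  assumes N: "N = real DIM('a::euclidean_space)"
    and K: "K = N * unit_ball_vol N * (2 powr (N - (N - 2 + \<theta>) * q) / (N - (N - 2 + \<theta>) * q))"
    and q: "(N - 2 + \<theta>) * q < N" "q > 0" and h: "h > 0"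
  shows "(\<integral>\<^sup>+ y. ennreal (near_bound DIM('a) \<theta> h (norm (y::'a)) powr q) \<partial>lborel)
      = ennreal (K * h powr (N - (N - 2) * q))"
proof -
  let ?e = "N - (N - 2 + \<theta>) * q"
  have "h powr (\<theta> * q) * h powr ?e = h powr (N - (N - 2) * q)"
    using h by (simp flip: powr_add) (simp add: algebra_simps)
  moreover have "(\<integral>\<^sup>+ y. ennreal (near_bound DIM('a) \<theta> h (norm (y::'a)) powr q) \<partial>lborel)
      = ennreal ((h powr \<theta>) powr q * (N * unit_ball_vol N * ((2 * h) powr ?e / ?e)))"
    unfolding near_bound_def using q h N
    by (subst nn_integral_scaled_powr_indicator)
       (auto simp: nn_integral_norm_powr_less ennreal_mult'[symmetric] mult.assoc)
  moreover have "(h powr \<theta>) powr q * (N * unit_ball_vol N * ((2 * h) powr ?e / ?e)) = K * (h powr (\<theta> * q) * h powr ?e)"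
    using h by (simp add: K powr_mult powr_powr)
  ultimately show ?thesis by simp
qed

text \<open>The radius \<open>R\<close> is kept apart from \<open>h\<close>: with R = h this is the
  norm of \<open>far_bound\<close>, while the logarithmic case cuts the tail at a radius of at least
  1.\<close>

lemma nn_integral_tail_bound:
  assumes N: "N = real DIM('a::euclidean_space)"
    and K: "K = N * unit_ball_vol N / ((N - 1) * q - N)"
    and q: "(N - 1) * q > N" "q > 0" and h: "h \<ge> 0" "R > 0"
  shows "(\<integral>\<^sup>+ y. ennreal ((h * (norm (y::'a) powr (- (real DIM('a) - 1)) * indicator {R..} (norm y))) powr q) \<partial>lborel)
      = ennreal (K * (h powr q * R powr (N - (N - 1) * q)))"
proof -
  have "(\<integral>\<^sup>+ y. ennreal ((h * (norm (y::'a) powr (- (real DIM('a) - 1)) * indicator {R..} (norm y))) powr q) \<partial>lborel)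
      = ennreal (h powr q * (N * unit_ball_vol N * (R powr (N - (N - 1) * q) / ((N - 1) * q - N))))"
    using q h N
    by (subst nn_integral_scaled_powr_indicator)
       (auto simp: nn_integral_norm_powr_greater ennreal_mult'[symmetric] mult.assoc)
  then show ?thesis by (simp add: K mult_ac)
qed

text \<open>The majorant \<open>\<Psi>\<close> is left free so that the far part may be cut into
  further pieces, each with its own dual exponent. The factor 2 counts the two poles
  \<open>x\<close> and \<open>z\<close>.\<close>

lemma newton_kernel_potential_diff_le:
  fixes f :: "'a::euclidean_space \<Rightarrow> real" and \<Psi> :: "real \<Rightarrow> real"
  assumes [measurable]: "f \<in> borel_measurable borel" "\<Psi> \<in> borel_measurable borel"
    and N: "DIM('a) \<ge> 2" and \<theta>: "0 < \<theta>" "\<theta> \<le> 1" and "x \<noteq> z"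
    and \<Psi>: "\<And>r. near_bound DIM('a) \<theta> (norm (x - z)) r + far_bound DIM('a) (norm (x - z)) r \<le> \<Psi> r"
    and B: "\<And>w. (\<integral>\<^sup>+ y. ennreal (\<bar>f y\<bar> * \<Psi> (norm (w - y))) \<partial>lborel) \<le> ennreal B" "B \<ge> 0"
  shows "(\<integral>\<^sup>+ y. ennreal \<bar>f y * (newton_kernel (x - y) - newton_kernel (z - y))\<bar> \<partial>lborel)
    \<le> ennreal (2 * newton_const DIM('a) / \<theta> * B)"
proof -
  let ?c = "newton_const DIM('a) / \<theta>"
  have c: "?c > 0" using newton_const_pos N \<theta> by simp
  have \<Psi>0: "\<Psi> r \<ge> 0" for r
    using \<Psi>[of r] near_bound_nonneg[of "DIM('a)" \<theta> "norm (x - z)" r] far_bound_nonneg[of "norm (x - z)" "DIM('a)" r]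
    by simp
  have "(\<integral>\<^sup>+ y. ennreal \<bar>f y * (newton_kernel (x - y) - newton_kernel (z - y))\<bar> \<partial>lborel) \<le>
     (\<integral>\<^sup>+ y. ennreal ?c * (ennreal (\<bar>f y\<bar> * \<Psi> (norm (x - y))) + ennreal (\<bar>f y\<bar> * \<Psi> (norm (z - y)))) \<partial>lborel)"
  proof (intro nn_integral_mono_AE)
    \<comment> \<open>At the poles the kernel has its default value 0 and the pointwise bound,
      stated for positive radii, does not apply; the two points are discarded.\<close>
    show "AE y in lborel. ennreal \<bar>f y * (newton_kernel (x - y) - newton_kernel (z - y))\<bar>
        \<le> ennreal ?c * (ennreal (\<bar>f y\<bar> * \<Psi> (norm (x - y))) + ennreal (\<bar>f y\<bar> * \<Psi> (norm (z - y))))"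
      using AE_lborel_singleton[of x] AE_lborel_singleton[of z]
    proof eventually_elim
      case (elim y)
      have "\<bar>norm (x - y) - norm (z - y)\<bar> \<le> norm (x - z)"
        using norm_triangle_ineq3[of "x - y" "z - y"] by simp
      then have "\<bar>newton_kernel (x - y) - newton_kernel (z - y)\<bar> \<le> ?c * (\<Psi> (norm (x - y)) + \<Psi> (norm (z - y)))"
        using newton_profile_diff_near_far[of "norm (x - y)" "norm (z - y)" "norm (x - z)" \<theta> "DIM('a)"] elim \<theta> N
          mult_left_mono[OF add_mono[OF \<Psi>[of "norm (x - y)"] \<Psi>[of "norm (z - y)"]] less_imp_le[OF c]]
        by (simp add: newton_kernel_def)
      then have "\<bar>f y * (newton_kernel (x - y) - newton_kernel (z - y))\<bar> \<le> \<bar>f y\<bar> * (?c * (\<Psi> (norm (x - y)) + \<Psi> (norm (z - y))))"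
        unfolding abs_mult by (intro mult_left_mono) auto
      also have "\<dots> = ?c * (\<bar>f y\<bar> * \<Psi> (norm (x - y)) + \<bar>f y\<bar> * \<Psi> (norm (z - y)))"
        by (simp add: algebra_simps)
      finally show ?case
        using c \<Psi>0 by (simp add: ennreal_plus[symmetric] ennreal_mult[symmetric] ennreal_leI del: ennreal_plus)
    qed
  qed
  also have "\<dots> = ennreal ?c * ((\<integral>\<^sup>+ y. ennreal (\<bar>f y\<bar> * \<Psi> (norm (x - y))) \<partial>lborel) + (\<integral>\<^sup>+ y. ennreal (\<bar>f y\<bar> * \<Psi> (norm (z - y))) \<partial>lborel))"
    by (simp add: nn_integral_cmult nn_integral_add)
  also have "\<dots> \<le> ennreal ?c * (ennreal B + ennreal B)"
    by (intro mult_left_mono add_mono B) auto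
  also have "\<dots> = ennreal (2 * newton_const DIM('a) / \<theta> * B)"
    using c \<open>B \<ge> 0\<close> by (simp add: ennreal_plus[symmetric] ennreal_mult[symmetric] mult_ac del: ennreal_plus)
  finally show ?thesis .
qed

section \<open>Hoelder and log-Lipschitz estimates for differences of potentials\<close>

lemma newton_kernel_potential_Holder_estimate:
  assumes N: "DIM('a::euclidean_space) \<ge> 2" and p: "real DIM('a) / 2 < p" "p < real DIM('a)"
  shows "\<exists>C\<ge>0. \<forall>(f :: 'a \<Rightarrow> real) A x z. f \<in> borel_measurable borel \<longrightarrow> A \<ge> 0 \<longrightarrow>
     (\<integral>\<^sup>+ y. ennreal (\<bar>f y\<bar> powr p) \<partial>lborel) \<le> ennreal A \<longrightarrow>
     (\<integral>\<^sup>+ y. ennreal \<bar>f y * (newton_kernel (x - y) - newton_kernel (z - y))\<bar> \<partial>lborel)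
       \<le> ennreal (C * norm (x - z) powr (2 - real DIM('a) / p) * A powr (1 / p))"
proof -
  define N where "N = real DIM('a)"
  define q where "q = p / (p - 1)"
  define \<beta> where "\<beta> = 2 - N / p"
  \<comment> \<open>Any value strictly between 0 and \<open>\<beta>\<close> serves; strictness is
    what makes the near part integrable.\<close>
  define \<theta> where "\<theta> = \<beta> / 2"
  have "N \<ge> 2" "N / 2 < p" "p < N" using assms by (auto simp: N_def)
  then have "p > 1" by simp
  then have q: "q > 1" "1 / p + 1 / q = 1" by (auto simp: q_def field_simps)
  have q': "1 / q = 1 - 1 / p" using q by simp
  have \<theta>: "0 < \<theta>" "\<theta> \<le> 1" "0 < \<beta>" "\<theta> < \<beta>"
    using \<open>p > 1\<close> \<open>N / 2 < p\<close> \<open>p < N\<close> by (auto simp: \<theta>_def \<beta>_def field_simps)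
  \<comment> \<open>In this form the two exponent conditions become \<open>\<theta>\<close> <
    \<open>\<beta>\<close> near the pole and \<open>\<beta>\<close> < 1 at infinity.\<close>
  have Nq: "N / q = \<beta> + N - 2"
    using arg_cong[OF q', of "(*) N"] by (simp add: \<beta>_def right_diff_distrib)
  then have Nq': "N = (\<beta> + N - 2) * q" using q by (simp add: field_simps)
  have near_exp: "(N - 2 + \<theta>) * q < N"
    using mult_strict_right_mono[of "N - 2 + \<theta>" "\<beta> + N - 2" q] \<theta> q Nq' by simp
  \<comment> \<open>Here p < N decides: equality would give \<open>\<beta>\<close> = 1 and a
    logarithmically divergent far part.\<close>
  have "\<beta> < 1" using \<open>p > 1\<close> \<open>p < N\<close> by (simp add: \<beta>_def field_simps)
  then have far_exp: "N < (N - 1) * q"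
    using mult_strict_right_mono[of "\<beta> + N - 2" "N - 1" q] q Nq' by simp
  have hexp: "N - (N - 2) * q = \<beta> * q" using Nq' by (simp add: algebra_simps)
  \<comment> \<open>\<open>K1\<close> and \<open>K2\<close> are the q-th powers of the dual norms of
    the near and the far part at h = 1.\<close>
  define K1 where "K1 = N * unit_ball_vol N * (2 powr (N - (N - 2 + \<theta>) * q) / (N - (N - 2 + \<theta>) * q))"
  define K2 where "K2 = N * unit_ball_vol N / ((N - 1) * q - N)"
  have K: "K1 \<ge> 0" "K2 \<ge> 0" using near_exp far_exp \<open>N \<ge> 2\<close> by (auto simp: K1_def K2_def)
  define C where "C = 2 * newton_const DIM('a) / \<theta> * (K1 powr (1 / q) + K2 powr (1 / q))"
  have "C \<ge> 0" using newton_const_pos[OF N] \<theta> by (auto simp: C_def)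
  moreover have "(\<integral>\<^sup>+ y. ennreal \<bar>f y * (newton_kernel (x - y) - newton_kernel (z - y))\<bar> \<partial>lborel)
       \<le> ennreal (C * norm (x - z) powr \<beta> * A powr (1 / p))"
    if [measurable]: "f \<in> borel_measurable borel" and A: "A \<ge> 0"
      and f: "(\<integral>\<^sup>+ y. ennreal (\<bar>f y\<bar> powr p) \<partial>lborel) \<le> ennreal A" for f :: "'a \<Rightarrow> real" and A x z
  proof (cases "x = z")
    case False
    define h where "h = norm (x - z)"
    have "h > 0" using False by (simp add: h_def)
    let ?near = "near_bound DIM('a) \<theta> h" and ?far = "far_bound DIM('a) h"
    have near: "(\<integral>\<^sup>+ y. ennreal (\<bar>f y\<bar> * ?near (norm (w - y))) \<partial>lborel)
        \<le> ennreal (A powr (1 / p) * (K1 * h powr (\<beta> * q)) powr (1 / q))" for w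
      using nn_integral_near_bound[where 'a='a, of N K1 \<theta> q h] near_exp q \<open>h > 0\<close> K N_def hexp
      by (intro nn_integral_potential_Holder[OF _ _ near_bound_nonneg \<open>p > 1\<close> q f A]) (auto simp: K1_def)
    have "h powr q * h powr (N - (N - 1) * q) = h powr (\<beta> * q)"
      using \<open>h > 0\<close> hexp by (simp flip: powr_add) (simp add: algebra_simps)
    then have far: "(\<integral>\<^sup>+ y. ennreal (\<bar>f y\<bar> * ?far (norm (w - y))) \<partial>lborel)
        \<le> ennreal (A powr (1 / p) * (K2 * h powr (\<beta> * q)) powr (1 / q))" for w
      using nn_integral_tail_bound[where 'a='a, of N K2 q h h] far_exp q \<open>h > 0\<close> K N_def
      by (intro nn_integral_potential_Holder[OF _ _ far_bound_nonneg \<open>p > 1\<close> q f A])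
         (auto simp: K2_def far_bound_def)
    have root: "(K * h powr (\<beta> * q)) powr (1 / q) = K powr (1 / q) * h powr \<beta>" if "K \<ge> 0" for K
      using that q \<open>h > 0\<close> by (simp add: powr_mult powr_powr)
    let ?B = "(K1 powr (1 / q) + K2 powr (1 / q)) * h powr \<beta> * A powr (1 / p)"
    have "(\<integral>\<^sup>+ y. ennreal (\<bar>f y\<bar> * (?near (norm (w - y)) + ?far (norm (w - y)))) \<partial>lborel) \<le> ennreal ?B" for w
    proof -
      have "(\<integral>\<^sup>+ y. ennreal (\<bar>f y\<bar> * (?near (norm (w - y)) + ?far (norm (w - y)))) \<partial>lborel) =
         (\<integral>\<^sup>+ y. ennreal (\<bar>f y\<bar> * ?near (norm (w - y))) + ennreal (\<bar>f y\<bar> * ?far (norm (w - y))) \<partial>lborel)"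
        using \<open>h > 0\<close> by (intro nn_integral_cong)
          (simp add: distrib_left near_bound_nonneg far_bound_nonneg)
      also have "\<dots> = (\<integral>\<^sup>+ y. ennreal (\<bar>f y\<bar> * ?near (norm (w - y))) \<partial>lborel) + (\<integral>\<^sup>+ y. ennreal (\<bar>f y\<bar> * ?far (norm (w - y))) \<partial>lborel)"
        by (subst nn_integral_add) auto
      also have "\<dots> \<le> ennreal (A powr (1 / p) * (K1 * h powr (\<beta> * q)) powr (1 / q)) + ennreal (A powr (1 / p) * (K2 * h powr (\<beta> * q)) powr (1 / q))"
        by (intro add_mono near far)
      also have "\<dots> = ennreal ?B"
        by (simp add: root K ennreal_plus[symmetric] algebra_simps del: ennreal_plus)
      finally show ?thesis .
    qed
    from newton_kernel_potential_diff_le[where \<Psi> = "\<lambda>r. ?near r + ?far r" and x=x and z=z, OF _ _ N \<theta>(1,2) False _ this]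
    show ?thesis by (simp add: h_def C_def mult_ac)
  qed simp
  ultimately show ?thesis unfolding \<beta>_def N_def by blast
qed

text \<open>The bound is split three ways: near part and annulus are paired with the L^N norm
  through its dual exponent \<open>Q\<close>, the tail with the L^r norm through \<open>r'\<close>.
  The root 1/Q of the annulus integral is the power of the logarithm.\<close>

lemma newton_kernel_potential_log_Lipschitz_estimate:
  assumes N: "DIM('a::euclidean_space) \<ge> 2" and r: "1 < r" "r < real DIM('a)"
  shows "\<exists>C\<ge>0. \<forall>(f :: 'a \<Rightarrow> real) A B x z. f \<in> borel_measurable borel \<longrightarrow> A \<ge> 0 \<longrightarrow> B \<ge> 0 \<longrightarrow>
     (\<integral>\<^sup>+ y. ennreal (\<bar>f y\<bar> powr real DIM('a)) \<partial>lborel) \<le> ennreal A \<longrightarrow>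
     (\<integral>\<^sup>+ y. ennreal (\<bar>f y\<bar> powr r) \<partial>lborel) \<le> ennreal B \<longrightarrow>
     (\<integral>\<^sup>+ y. ennreal \<bar>f y * (newton_kernel (x - y) - newton_kernel (z - y))\<bar> \<partial>lborel)
       \<le> ennreal (C * norm (x - z) * (\<bar>ln (norm (x - z))\<bar> + 1) powr (1 / (real DIM('a) / (real DIM('a) - 1)))
           * (A powr (1 / real DIM('a)) + B powr (1 / r)))"
proof -
  define N where "N = real DIM('a)"
  define Q where "Q = N / (N - 1)"
  define r' where "r' = r / (r - 1)"
  \<comment> \<open>For p = N the critical value 2 - N/p is 1, and one half stays below it.\<close>
  define \<theta> where "\<theta> = (1 / 2 :: real)"
  have "N \<ge> 2" using assms by (auto simp: N_def)
  then have "N > 1" by simp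
  have Q: "Q > 1" "1 / N + 1 / Q = 1" using \<open>N > 1\<close> by (auto simp: Q_def field_simps)
  have r': "r' > 1" "1 / r + 1 / r' = 1" using r by (auto simp: r'_def field_simps)
  have \<theta>: "0 < \<theta>" "\<theta> \<le> 1" by (auto simp: \<theta>_def)
  \<comment> \<open>The borderline identity: together with the Jacobian r^(N-1), the Q-th power of
    the far kernel is a multiple of 1/r.\<close>
  have NQ: "(N - 1) * Q = N" using \<open>N > 1\<close> by (simp add: Q_def)
  have near_exp: "(N - 2 + \<theta>) * Q < N"
    using mult_strict_right_mono[of "N - 2 + \<theta>" "N - 1" Q] Q NQ by (simp add: \<theta>_def)
  \<comment> \<open>Equivalent to N - N/r < N - 1, that is, to r < N.\<close>
  have far_exp: "N < (N - 1) * r'"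
    using r \<open>N > 1\<close> by (simp add: r'_def N_def[symmetric] field_simps)
  have hexp: "N - (N - 2) * Q = Q" using NQ by (simp add: algebra_simps)
  define K1 where "K1 = N * unit_ball_vol N * (2 powr (N - (N - 2 + \<theta>) * Q) / (N - (N - 2 + \<theta>) * Q))"
  define K2 where "K2 = N * unit_ball_vol N"
  define K3 where "K3 = N * unit_ball_vol N / ((N - 1) * r' - N)"
  have K: "K1 \<ge> 0" "K2 \<ge> 0" "K3 \<ge> 0" using near_exp far_exp \<open>N \<ge> 2\<close> by (auto simp: K1_def K2_def K3_def)
  define D where "D = K1 powr (1 / Q) + K2 powr (1 / Q) + K3 powr (1 / r')"
  define C where "C = 2 * newton_const DIM('a) / \<theta> * D"
  have "C \<ge> 0" using newton_const_pos[OF N] \<theta> by (auto simp: C_def D_def)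
  moreover have "(\<integral>\<^sup>+ y. ennreal \<bar>f y * (newton_kernel (x - y) - newton_kernel (z - y))\<bar> \<partial>lborel)
       \<le> ennreal (C * norm (x - z) * (\<bar>ln (norm (x - z))\<bar> + 1) powr (1 / Q) * (A powr (1 / N) + B powr (1 / r)))"
    if [measurable]: "f \<in> borel_measurable borel" and A: "A \<ge> 0" "B \<ge> 0"
      and f: "(\<integral>\<^sup>+ y. ennreal (\<bar>f y\<bar> powr N) \<partial>lborel) \<le> ennreal A"
      and fr: "(\<integral>\<^sup>+ y. ennreal (\<bar>f y\<bar> powr r) \<partial>lborel) \<le> ennreal B" for f :: "'a \<Rightarrow> real" and A B x z
  proof (cases "x = z")
    case False
    define h where "h = norm (x - z)"
    have "h > 0" using False by (simp add: h_def)
    \<comment> \<open>With this cut, ln R - ln h is the absolute value of ln h for h < 1 and 0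
      otherwise, and R being at least 1 bounds the norm of the tail by a multiple of h
      uniformly.\<close>
    define R where "R = max 1 h"
    have R: "R \<ge> 1" "R \<ge> h" by (auto simp: R_def)
    let ?L = "(\<bar>ln h\<bar> + 1) powr (1 / Q)"
    \<comment> \<open>The summand 1 beside the logarithm lets the near part and the tail, which
      carry no logarithm, absorb this factor.\<close>
    have L: "?L \<ge> 1" using Q by (intro ge_one_powr_ge_zero) auto
    define a where "a = A powr (1 / N)"
    define b where "b = B powr (1 / r)"
    have ab: "a \<ge> 0" "b \<ge> 0" by (auto simp: a_def b_def)
    define mid where "mid = (\<lambda>t. h * (t powr (- (real DIM('a) - 1)) * indicator {h..R} t))"
    define tail where "tail = (\<lambda>t. h * (t powr (- (real DIM('a) - 1)) * indicator {R..} t))"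
    have [measurable]: "mid \<in> borel_measurable borel" "tail \<in> borel_measurable borel"
      by (auto simp: mid_def tail_def)
    have nonneg: "mid t \<ge> 0" "tail t \<ge> 0" for t
      using \<open>h > 0\<close> by (auto simp: mid_def tail_def)
    let ?near = "near_bound DIM('a) \<theta> h"
    have "(\<integral>\<^sup>+ y. ennreal (\<bar>f y\<bar> * ?near (norm (w - y))) \<partial>lborel)
        \<le> ennreal (a * (K1 * h powr Q) powr (1 / Q))" for w
      unfolding a_def
      using nn_integral_near_bound[where 'a='a, of N K1 \<theta> Q h] near_exp Q \<open>h > 0\<close> K N_def hexp
      by (intro nn_integral_potential_Holder[OF _ _ near_bound_nonneg \<open>N > 1\<close> Q f A(1)]) (auto simp: K1_def)
    moreover have "(K1 * h powr Q) powr (1 / Q) = K1 powr (1 / Q) * h"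
      using Q \<open>h > 0\<close> K by (simp add: powr_mult powr_powr)
    moreover have "K1 powr (1 / Q) * h * 1 \<le> K1 powr (1 / Q) * h * ?L"
      using L \<open>h > 0\<close> by (intro mult_left_mono) auto
    ultimately have near: "(\<integral>\<^sup>+ y. ennreal (\<bar>f y\<bar> * ?near (norm (w - y))) \<partial>lborel)
        \<le> ennreal (a * (K1 powr (1 / Q) * h * ?L))" for w
      using ab by (force elim!: order_trans intro!: ennreal_leI mult_left_mono)
    have "(\<integral>\<^sup>+ y. ennreal (mid (norm (y::'a)) powr Q) \<partial>lborel) = ennreal (h powr Q * (K2 * (ln R - ln h)))"
      unfolding mid_def using \<open>h > 0\<close> R Q NQ N_def K
      by (subst nn_integral_scaled_powr_indicator)
         (auto simp: nn_integral_norm_powr_log K2_def ennreal_mult)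
    also have "\<dots> \<le> ennreal (h powr Q * (K2 * (\<bar>ln h\<bar> + 1)))"
      using \<open>h > 0\<close> K by (intro ennreal_leI mult_left_mono) (auto simp: R_def max_def)
    finally have "(\<integral>\<^sup>+ y. ennreal (\<bar>f y\<bar> * mid (norm (w - y))) \<partial>lborel)
        \<le> ennreal (a * (h powr Q * (K2 * (\<bar>ln h\<bar> + 1))) powr (1 / Q))" for w
      unfolding a_def using K
      by (intro nn_integral_potential_Holder[OF _ _ nonneg(1) \<open>N > 1\<close> Q f A(1)]) auto
    moreover have "(h powr Q * (K2 * (\<bar>ln h\<bar> + 1))) powr (1 / Q) = K2 powr (1 / Q) * h * ?L"
      using Q \<open>h > 0\<close> K by (simp add: powr_mult powr_powr)
    ultimately have mid: "(\<integral>\<^sup>+ y. ennreal (\<bar>f y\<bar> * mid (norm (w - y))) \<partial>lborel)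
        \<le> ennreal (a * (K2 powr (1 / Q) * h * ?L))" for w
      by simp
    have "(\<integral>\<^sup>+ y. ennreal (tail (norm (y::'a)) powr r') \<partial>lborel) = ennreal (K3 * (h powr r' * R powr (N - (N - 1) * r')))"
      using nn_integral_tail_bound[where 'a='a, of N K3 r' h R] far_exp r' \<open>h > 0\<close> R N_def
      by (auto simp: tail_def K3_def)
    also have "\<dots> \<le> ennreal (K3 * (h powr r' * 1))"
      using far_exp R K powr_mono[of "N - (N - 1) * r'" 0 R]
      by (intro ennreal_leI mult_left_mono) auto
    finally have "(\<integral>\<^sup>+ y. ennreal (\<bar>f y\<bar> * tail (norm (w - y))) \<partial>lborel)
        \<le> ennreal (b * (K3 * (h powr r' * 1)) powr (1 / r'))" for w
      unfolding b_def using K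
      by (intro nn_integral_potential_Holder[OF _ _ nonneg(2) r(1) r' fr A(2)]) auto
    moreover have "(K3 * (h powr r' * 1)) powr (1 / r') = K3 powr (1 / r') * h"
      using r' \<open>h > 0\<close> K by (simp add: powr_mult powr_powr)
    moreover have "K3 powr (1 / r') * h * 1 \<le> K3 powr (1 / r') * h * ?L"
      using L \<open>h > 0\<close> by (intro mult_left_mono) auto
    ultimately have tail: "(\<integral>\<^sup>+ y. ennreal (\<bar>f y\<bar> * tail (norm (w - y))) \<partial>lborel)
        \<le> ennreal (b * (K3 powr (1 / r') * h * ?L))" for w
      using ab by (force elim!: order_trans intro!: ennreal_leI mult_left_mono)
    let ?B = "D * h * ?L * (a + b)"
    have "(\<integral>\<^sup>+ y. ennreal (\<bar>f y\<bar> * (?near (norm (w - y)) + (mid (norm (w - y)) + tail (norm (w - y))))) \<partial>lborel) \<le> ennreal ?B" for w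
    proof -
      have "(\<integral>\<^sup>+ y. ennreal (\<bar>f y\<bar> * (?near (norm (w - y)) + (mid (norm (w - y)) + tail (norm (w - y))))) \<partial>lborel) =
         (\<integral>\<^sup>+ y. ennreal (\<bar>f y\<bar> * ?near (norm (w - y))) + (ennreal (\<bar>f y\<bar> * mid (norm (w - y))) + ennreal (\<bar>f y\<bar> * tail (norm (w - y)))) \<partial>lborel)"
        using \<open>h > 0\<close> by (intro nn_integral_cong)
          (simp add: distrib_left near_bound_nonneg nonneg)
      also have "\<dots> = (\<integral>\<^sup>+ y. ennreal (\<bar>f y\<bar> * ?near (norm (w - y))) \<partial>lborel) + ((\<integral>\<^sup>+ y. ennreal (\<bar>f y\<bar> * mid (norm (w - y))) \<partial>lborel) + (\<integral>\<^sup>+ y. ennreal (\<bar>f y\<bar> * tail (norm (w - y))) \<partial>lborel))"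
        by (simp add: nn_integral_add)
      also have "\<dots> \<le> ennreal (a * (K1 powr (1 / Q) * h * ?L)) + (ennreal (a * (K2 powr (1 / Q) * h * ?L)) + ennreal (b * (K3 powr (1 / r') * h * ?L)))"
        by (intro add_mono near mid tail)
      also have "\<dots> = ennreal (a * (K1 powr (1 / Q) * h * ?L) + (a * (K2 powr (1 / Q) * h * ?L) + b * (K3 powr (1 / r') * h * ?L)))"
        using ab \<open>h > 0\<close> by (simp add: ennreal_plus[symmetric] del: ennreal_plus)
      also have "\<dots> \<le> ennreal ?B"
      proof (intro ennreal_leI)
        \<comment> \<open>Adding the missing nonnegative cross terms completes the sum to the
          product of \<open>D\<close> and a + b.\<close>
        have "0 \<le> (K1 powr (1 / Q) + K2 powr (1 / Q)) * h * ?L * b + K3 powr (1 / r') * h * ?L * a"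
          using ab \<open>h > 0\<close> by (intro add_nonneg_nonneg mult_nonneg_nonneg) auto
        then show "a * (K1 powr (1 / Q) * h * ?L) + (a * (K2 powr (1 / Q) * h * ?L) + b * (K3 powr (1 / r') * h * ?L)) \<le> ?B"
          by (simp add: D_def algebra_simps)
      qed
      finally show ?thesis .
    qed
    moreover have "?near t + far_bound DIM('a) h t \<le> ?near t + (mid t + tail t)" for t
      using \<open>h > 0\<close> by (auto simp: far_bound_def mid_def tail_def split: split_indicator)
    moreover have "?B \<ge> 0" using ab \<open>h > 0\<close> by (auto simp: D_def)
    ultimately show ?thesis
      using newton_kernel_potential_diff_le[where \<Psi> = "\<lambda>t. ?near t + (mid t + tail t)" and x=x and z=z and B = ?B and f = f, OF _ _ N \<theta> False]
      by (simp add: h_def C_def a_def b_def mult_ac)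
  qed simp
  ultimately show ?thesis unfolding Q_def N_def by blast
qed

section \<open>Green's identity and the fundamental solution\<close>

lemma integrable_continuous_bounded_support:
  fixes g :: "'a::euclidean_space \<Rightarrow> real"
  assumes g: "continuous_on UNIV g" and supp: "\<And>x. norm x > R \<Longrightarrow> g x = 0"
  shows "integrable lborel g"
proof -
  have "integrable lborel (\<lambda>x. indicator (cball 0 R) x *\<^sub>R g x)"
    using g by (intro borel_integrable_compact) (auto intro: continuous_on_subset)
  moreover have "(\<lambda>x. indicator (cball 0 R) x *\<^sub>R g x) = g"
    using supp by (auto simp: fun_eq_iff split: split_indicator)
  ultimately show ?thesis by simp
qed

lemma bounded_continuous_bounded_support:
  fixes g :: "'a::euclidean_space \<Rightarrow> real"
  assumes g: "continuous_on UNIV g" and supp: "\<And>x. norm x > R \<Longrightarrow> g x = 0"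
  obtains M where "M > 0" "\<And>x. \<bar>g x\<bar> \<le> M"
proof -
  have "compact (g ` cball 0 R)"
    using g by (intro compact_continuous_image) (auto intro: continuous_on_subset)
  then obtain M where M: "M > 0" "\<And>y. y \<in> g ` cball 0 R \<Longrightarrow> norm y \<le> M"
    by (meson bounded_pos compact_imp_bounded)
  have "\<bar>g x\<bar> \<le> M" for x
    using M supp[of x] by (cases "norm x > R") auto
  with M show ?thesis using that by blast
qed

lemma directional_derivative_zero_outside:
  fixes g :: "'a::euclidean_space \<Rightarrow> real"
  assumes d: "((\<lambda>t. g (x + t *\<^sub>R b)) has_real_derivative d) (at 0)"
    and supp: "\<And>x. norm x > R \<Longrightarrow> g x = 0" and x: "norm x > R"
  shows "d = 0"
proof -
  have "((\<lambda>t. norm (x + t *\<^sub>R b)) \<longlongrightarrow> norm (x + 0 *\<^sub>R b)) (nhds 0)"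
    by (intro tendsto_intros filterlim_ident)
  then have "eventually (\<lambda>t. norm (x + t *\<^sub>R b) > R) (nhds 0)"
    using x by (intro order_tendstoD) auto
  then have "eventually (\<lambda>t. g (x + t *\<^sub>R b) = 0) (nhds 0)"
    by eventually_elim (rule supp)
  then have "((\<lambda>t. 0) has_real_derivative d) (at 0)"
    using d DERIV_cong_ev[OF refl _ refl] by fast
  then show ?thesis using DERIV_unique DERIV_const by blast
qed

lemma integral_lborel_shift:
  fixes f :: "'a::euclidean_space \<Rightarrow> real"
  assumes [measurable]: "f \<in> borel_measurable borel"
  shows "(\<integral>x. f (x + y) \<partial>lborel) = (\<integral>x. f x \<partial>lborel)"
proof -
  have "(\<integral>x. f x \<partial>distr lborel borel ((+) y)) = (\<integral>x. f (x + y) \<partial>lborel)"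
    by (subst integral_distr) (auto simp: add.commute)
  then show ?thesis by (simp add: lborel_distr_plus)
qed

text \<open>The difference quotients of \<open>g\<close> in direction \<open>b\<close> have integral zero by translation invariance.\<close>

lemma integral_directional_derivative_eq_0:
  fixes g g' :: "'a::euclidean_space \<Rightarrow> real"
  assumes d: "\<And>x. ((\<lambda>t. g (x + t *\<^sub>R b)) has_real_derivative g' x) (at 0)"
    and g: "continuous_on UNIV g" and g': "continuous_on UNIV g'"
    and supp: "\<And>x. norm x > R \<Longrightarrow> g x = 0"
  shows "(\<integral>x. g' x \<partial>lborel) = 0"
proof -
  have supp': "g' x = 0" if "norm x > R" for x
    using directional_derivative_zero_outside[OF d supp that] by blast
  obtain M where M: "M > 0" "\<And>x. \<bar>g' x\<bar> \<le> M"
    using bounded_continuous_bounded_support[OF g' supp'] by blast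
  \<comment> \<open>The hypothesis differentiates at t = 0 only, but for every base point; moving
    the base point gives the derivative along the whole line, as the mean value theorem
    requires.\<close>
  have d': "((\<lambda>t. g (x + t *\<^sub>R b)) has_real_derivative g' (x + t *\<^sub>R b)) (at t)" for x t
  proof -
    have "((\<lambda>s. g (x + (s + t) *\<^sub>R b)) has_real_derivative g' (x + t *\<^sub>R b)) (at 0)"
      using d[of "x + t *\<^sub>R b"] by (simp add: algebra_simps)
    then show ?thesis
      using DERIV_shift[of "\<lambda>t. g (x + t *\<^sub>R b)" _ 0 t] by simp
  qed
  have g_meas [measurable]: "g \<in> borel_measurable borel" and [measurable]: "g' \<in> borel_measurable borel"
    using g g' by (auto intro: borel_measurable_continuous_onI)
  have g_int: "integrable lborel g"
    by (rule integrable_continuous_bounded_support[OF g supp])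
  define \<tau> where "\<tau> = (\<lambda>n. inverse (real (Suc n)))"
  have \<tau>: "\<tau> n > 0" "\<tau> n \<le> 1" for n by (auto simp: \<tau>_def field_simps)
  define s where "s = (\<lambda>n x. (g (x + \<tau> n *\<^sub>R b) - g x) / \<tau> n)"
  have "(\<lambda>n. \<integral>x. s n x \<partial>lborel) \<longlonglongrightarrow> (\<integral>x. g' x \<partial>lborel)"
  proof (rule integral_dominated_convergence)
    show "g' \<in> borel_measurable lborel" "\<And>n. s n \<in> borel_measurable lborel"
      by (auto simp: s_def)
    \<comment> \<open>The steps are at most 1, so a difference quotient can be nonzero only within
      distance norm b of the ball of radius R.\<close>
    show "integrable lborel (\<lambda>x::'a. M * indicat_real (cball 0 (R + norm b)) x)"
      by (intro integrable_mult_right integrable_real_indicator) (use emeasure_lborel_cball_finite[of "0::'a" "R + norm b"] in auto)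
    show "AE x in lborel. norm (s n x) \<le> M * indicat_real (cball 0 (R + norm b)) x" for n
    proof (rule AE_I2)
      fix x
      obtain \<xi> where \<xi>: "0 < \<xi>" "\<xi> < \<tau> n" "g (x + \<tau> n *\<^sub>R b) - g (x + 0 *\<^sub>R b) = (\<tau> n - 0) * g' (x + \<xi> *\<^sub>R b)"
        using MVT2[of 0 "\<tau> n" "\<lambda>t. g (x + t *\<^sub>R b)" "\<lambda>t. g' (x + t *\<^sub>R b)"] d' \<tau>[of n] by metis
      then have s: "s n x = g' (x + \<xi> *\<^sub>R b)"
        using \<tau>[of n] by (simp add: s_def)
      show "norm (s n x) \<le> M * indicat_real (cball 0 (R + norm b)) x"
      proof (cases "norm x \<le> R + norm b")
        case False
        have "norm x \<le> norm (x + \<xi> *\<^sub>R b) + norm (\<xi> *\<^sub>R b)"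
          using norm_triangle_ineq4[of "x + \<xi> *\<^sub>R b" "\<xi> *\<^sub>R b"] by simp
        moreover have "norm (\<xi> *\<^sub>R b) \<le> norm b"
          using \<xi> \<tau>[of n] by (auto intro: mult_left_le_one_le)
        ultimately have "g' (x + \<xi> *\<^sub>R b) = 0" using False by (intro supp') linarith
        then show ?thesis using s M by simp
      qed (use s M in auto)
    qed
    show "AE x in lborel. (\<lambda>n. s n x) \<longlonglongrightarrow> g' x"
    proof (rule AE_I2)
      fix x
      have "((\<lambda>h. (g (x + h *\<^sub>R b) - g x) / h) \<longlongrightarrow> g' x) (at 0)"
        using d[of x] by (simp add: DERIV_def)
      moreover have "filterlim \<tau> (at 0) sequentially"
        using \<tau>(1) LIMSEQ_inverse_real_of_nat unfolding \<tau>_def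
        by (intro filterlim_atI) (auto intro!: always_eventually)
      ultimately show "(\<lambda>n. s n x) \<longlonglongrightarrow> g' x"
        unfolding s_def by (rule filterlim_compose)
    qed
  qed
  moreover have "(\<integral>x. s n x \<partial>lborel) = 0" for n
  proof -
    have shift: "distr lborel borel ((+) (\<tau> n *\<^sub>R b)) = lborel" by (rule lborel_distr_plus)
    have "integrable (distr lborel borel ((+) (\<tau> n *\<^sub>R b))) g" using g_int by (simp add: shift)
    then have int: "integrable lborel (\<lambda>x. g (x + \<tau> n *\<^sub>R b))"
      by (subst (asm) integrable_distr_eq) (auto simp: add.commute)
    have "(\<integral>x. g (x + \<tau> n *\<^sub>R b) \<partial>lborel) = (\<integral>x. g x \<partial>lborel)"
      by (rule integral_lborel_shift) simp
    then show ?thesis using int g_int by (simp add: s_def)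
  qed
  ultimately show ?thesis using LIMSEQ_unique[OF tendsto_const] by fastforce
qed

lemma newton_profile_antimono:
  assumes "0 < s" "s \<le> t" "N \<ge> 2"
  shows "newton_profile N t \<le> newton_profile N s"
  using assms powr_mono2'[of "- (real N - 2) / 2" s t] by (simp add: newton_profile_def)

lemma continuous_on_newton_profile: "continuous_on {0<..} (newton_profile N)"
  by (rule DERIV_continuous_on, rule has_field_derivative_at_within, rule DERIV_newton_profile) simp

text \<open>Comparing with the value at radius R by means of the difference bound with exponent 1
  dominates the kernel by a constant plus a multiple of |x|^(1-N). Logarithm and power are covered
  at once.\<close>

lemma integrable_newton_kernel_cball:
  assumes N: "DIM('a::euclidean_space) \<ge> 2" and R: "R > 0"
  shows "integrable lborel (\<lambda>x::'a. indicator (cball 0 R) x * newton_kernel x)"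
proof -
  let ?N = "DIM('a)"
  let ?c = "newton_const ?N"
  have c: "?c > 0" using newton_const_pos N by auto
  let ?p = "\<lambda>x::'a. norm x powr (- (real ?N - 1)) * indicator {0..R} (norm x)"
  have "(\<integral>\<^sup>+ x. ennreal (?p x) \<partial>lborel) < \<infinity>"
  proof -
    have "(\<integral>\<^sup>+ x. ennreal (?p x) \<partial>lborel)
        = (\<integral>\<^sup>+ x. ennreal (norm x powr (- (real ?N - 1))) * indicator {0..R} (norm (x::'a)) \<partial>lborel)"
      by (intro nn_integral_cong) (auto split: split_indicator)
    also have "\<dots> < \<infinity>" using R by (subst nn_integral_norm_powr_less) auto
    finally show ?thesis .
  qed
  then have p: "integrable lborel ?p"
    by (intro integrableI_nonneg) auto
  have b: "integrable lborel (\<lambda>x::'a. indicator (cball 0 R) x :: real)"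
    using emeasure_lborel_cball_finite[of "0::'a" R] by simp
  show ?thesis
  proof (rule Bochner_Integration.integrable_bound)
    show "integrable lborel (\<lambda>x::'a. \<bar>newton_profile ?N (R\<^sup>2)\<bar> * indicator (cball 0 R) x + ?c * R * ?p x)"
      using p b by (intro Bochner_Integration.integrable_add integrable_mult_right)
    show "AE x::'a in lborel. norm (indicator (cball 0 R) x * newton_kernel x)
        \<le> norm (\<bar>newton_profile ?N (R\<^sup>2)\<bar> * indicator (cball 0 R) x + ?c * R * ?p x)"
      using AE_lborel_singleton[of 0]
    proof eventually_elim
      case (elim x)
      show ?case
      proof (cases "norm x \<le> R")
        case True
        have "\<bar>newton_profile ?N ((norm x)\<^sup>2) - newton_profile ?N (R\<^sup>2)\<bar>
            \<le> ?c / 1 * (R - norm x) powr 1 * norm x powr (- (real ?N - 2 + 1))"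
          using elim True N by (intro newton_profile_diff_le) auto
        also have "\<dots> \<le> ?c * R * norm x powr (- (real ?N - 1))"
          using True c by (auto intro!: mult_left_mono mult_right_mono)
        finally have "\<bar>newton_profile ?N ((norm x)\<^sup>2)\<bar> \<le> \<bar>newton_profile ?N (R\<^sup>2)\<bar> + ?c * R * norm x powr (- (real ?N - 1))"
          by linarith
        then show ?thesis using True by (simp add: newton_kernel_def)
      qed simp
    qed
    have "newton_kernel \<in> borel_measurable (borel :: 'a measure)" by (rule measurable_newton_kernel)
    then show "(\<lambda>x::'a. indicator (cball 0 R) x * newton_kernel x) \<in> borel_measurable lborel"
      by (intro borel_measurable_times borel_measurable_indicator) auto
  qed
qed

lemma integral_lborel_scaleR:
  fixes f :: "'a::euclidean_space \<Rightarrow> real"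
  assumes [measurable]: "f \<in> borel_measurable borel" and "c > 0"
  shows "(\<integral>x. f x \<partial>lborel) = c ^ DIM('a) * (\<integral>x. f (c *\<^sub>R x) \<partial>lborel)"
proof -
  have "(\<integral>x. f x \<partial>lborel) = (\<integral>x. f x \<partial>density (distr lborel borel (\<lambda>x::'a. c *\<^sub>R x)) (\<lambda>_. ennreal (c ^ DIM('a))))"
    using lborel_affine[of c "0::'a"] \<open>c > 0\<close> by simp
  also have "\<dots> = (\<integral>x. c ^ DIM('a) * f x \<partial>distr lborel borel (\<lambda>x::'a. c *\<^sub>R x))"
    using \<open>c > 0\<close> by (subst integral_density) auto
  also have "\<dots> = c ^ DIM('a) * (\<integral>x. f (c *\<^sub>R x) \<partial>lborel)"
    by (subst integral_distr) auto
  finally show ?thesis .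
qed

lemma has_bochner_integral_inverse_quadratic_power:
  "has_bochner_integral lborel (\<lambda>x::'a::euclidean_space. (1 + (norm x)\<^sup>2) powr (- (real DIM('a) / 2 + 1)))
     (unit_ball_vol DIM('a))"
  using nn_integral_inverse_quadratic_power[where 'a='a]
  by (intro has_bochner_integral_nn_integral) auto

text \<open>This is exactly the regularity that Green's identity consumes: two derivatives along
  each coordinate line, their continuity, and vanishing outside a ball. With the derivatives as
  parameters, closure under translation is immediate.\<close>

locale C2_bounded_support =
  fixes \<phi> :: "'a::euclidean_space \<Rightarrow> real" and D DD :: "'a \<Rightarrow> 'a \<Rightarrow> real" and R :: real
  assumes deriv: "b \<in> Basis \<Longrightarrow> ((\<lambda>t. \<phi> (x + t *\<^sub>R b)) has_real_derivative D b x) (at 0)"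
    and deriv2: "b \<in> Basis \<Longrightarrow> ((\<lambda>t. D b (x + t *\<^sub>R b)) has_real_derivative DD b x) (at 0)"
    and cont: "continuous_on UNIV \<phi>"
    and cont_deriv: "b \<in> Basis \<Longrightarrow> continuous_on UNIV (D b)"
    and cont_deriv2: "b \<in> Basis \<Longrightarrow> continuous_on UNIV (DD b)"
    and supp: "norm x > R \<Longrightarrow> \<phi> x = 0"
begin

definition Lap :: "'a \<Rightarrow> real" where
  "Lap x = (\<Sum>b\<in>Basis. DD b x)"

lemma supp_deriv: "b \<in> Basis \<Longrightarrow> norm x > R \<Longrightarrow> D b x = 0"
  using directional_derivative_zero_outside[OF deriv supp] by blast

lemma supp_deriv2: "b \<in> Basis \<Longrightarrow> norm x > R \<Longrightarrow> DD b x = 0"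
  using directional_derivative_zero_outside[OF deriv2 supp_deriv] by blast

lemma supp_Lap: "norm x > R \<Longrightarrow> Lap x = 0"
  by (simp add: Lap_def supp_deriv2)

lemma cont_Lap: "continuous_on UNIV Lap"
  unfolding Lap_def[abs_def] by (intro continuous_on_sum cont_deriv2)

text \<open>This removes the reference term k(-y) of the modified potential when it is tested
  against a Laplacian.\<close>

lemma integral_Lap: "(\<integral>x. Lap x \<partial>lborel) = 0"
proof -
  have "integrable lborel (DD b)" if "b \<in> Basis" for b
    using integrable_continuous_bounded_support[OF cont_deriv2 supp_deriv2] that by blast
  then have "(\<integral>x. Lap x \<partial>lborel) = (\<Sum>b\<in>Basis. \<integral>x. DD b x \<partial>lborel)"
    unfolding Lap_def by (rule Bochner_Integration.integral_sum)
  also have "\<dots> = 0"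
    by (intro sum.neutral ballI integral_directional_derivative_eq_0[OF deriv2 cont_deriv cont_deriv2 supp_deriv])
  finally show ?thesis .
qed

text \<open>Green's identity against the regularised kernel \<open>newton_profile N (\<bar>x\<bar>\<^sup>2 + e)\<close>, whose Laplacian is \<open>- c N e (\<bar>x\<bar>\<^sup>2 + e)\<^bsup>-N/2-1\<^esup>\<close>.\<close>

lemma Green_regularised:
  assumes e: "e > 0"
  shows "(\<integral>x. newton_profile DIM('a) ((norm x)\<^sup>2 + e) * Lap x \<partial>lborel) =
    - (newton_const DIM('a) * DIM('a)) *
       (\<integral>x. e * ((norm x)\<^sup>2 + e) powr (- (real DIM('a) / 2 + 1)) * \<phi> x \<partial>lborel)"
proof -
  define N where "N = DIM('a)"
  define c where "c = newton_const N"
  define S where "S = (\<lambda>x::'a. (norm x)\<^sup>2 + e)"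
  have S: "S x > 0" for x using e by (simp add: S_def add_nonneg_pos)
  define k where "k = (\<lambda>x. newton_profile N (S x))"
  \<comment> \<open>\<open>k1\<close> and \<open>k2\<close> are the first and second derivatives of
    the regularised kernel \<open>k\<close> in direction b.\<close>
  define k1 where "k1 = (\<lambda>b x. - c * S x powr (- real N / 2) * (x \<bullet> b))"
  define k2 where "k2 = (\<lambda>b x. - c * S x powr (- real N / 2) + c * N * S x powr (- real N / 2 - 1) * (x \<bullet> b)\<^sup>2)"
  have dS: "((\<lambda>t. S (x + t *\<^sub>R b)) has_real_derivative 2 * (x \<bullet> b)) (at 0)" if "b \<in> Basis" for x b
  proof -
    have "S (x + t *\<^sub>R b) = S x + 2 * t * (x \<bullet> b) + t\<^sup>2" for t
    proof -
      have "(norm (x + t *\<^sub>R b))\<^sup>2 = (norm x)\<^sup>2 + 2 * (x \<bullet> (t *\<^sub>R b)) + (norm (t *\<^sub>R b))\<^sup>2"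
        by (simp only: dot_norm) (simp add: field_simps)
      then show ?thesis using that by (simp add: S_def power_mult_distrib)
    qed
    then show ?thesis by (auto intro!: derivative_eq_intros)
  qed
  have dk: "((\<lambda>t. k (x + t *\<^sub>R b)) has_real_derivative k1 b x) (at 0)" if "b \<in> Basis" for x b
  proof -
    have "((\<lambda>t. newton_profile N (S (x + t *\<^sub>R b))) has_real_derivative
        (- (newton_const N / 2) * S (x + 0 *\<^sub>R b) powr (- real N / 2)) * (2 * (x \<bullet> b))) (at 0)"
      using S[of x] by (intro DERIV_chain2[OF DERIV_newton_profile dS[OF that]]) simp
    then show ?thesis by (simp add: k_def k1_def c_def mult_ac)
  qed
  have dk1: "((\<lambda>t. k1 b (x + t *\<^sub>R b)) has_real_derivative k2 b x) (at 0)" if "b \<in> Basis" for x b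
  proof -
    have p: "((\<lambda>t. S (x + t *\<^sub>R b) powr (- real N / 2)) has_real_derivative
       (- real N / 2) * S (x + 0 *\<^sub>R b) powr (- real N / 2 - 1) * (2 * (x \<bullet> b))) (at 0)"
      using S[of x] by (intro DERIV_chain2[OF has_real_derivative_powr dS[OF that]]) simp
    have q: "((\<lambda>t. (x + t *\<^sub>R b) \<bullet> b) has_real_derivative 1) (at 0)"
      using that by (auto intro!: derivative_eq_intros simp: inner_add_left)
    show ?thesis
      unfolding k1_def using DERIV_cmult[OF DERIV_mult[OF p q], of "- c"]
      by (simp add: k2_def algebra_simps power2_eq_square)
  qed
  have cS: "continuous_on UNIV S" unfolding S_def by (intro continuous_intros)
  have cp: "continuous_on UNIV (\<lambda>x. S x powr a)" for a
  proof (rule continuous_on_powr[OF cS continuous_on_const])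
    show "\<forall>x\<in>UNIV. S x \<noteq> 0" using S less_irrefl by metis
  qed
  have ck: "continuous_on UNIV k"
    unfolding k_def by (rule continuous_on_compose2[OF continuous_on_newton_profile cS]) (use S in auto)
  have ck1: "continuous_on UNIV (k1 b)" for b
    unfolding k1_def by (intro continuous_intros cp)
  have ck2: "continuous_on UNIV (k2 b)" for b
    unfolding k2_def by (intro continuous_intros cp)
  \<comment> \<open>Two integrations by parts in one: differentiating k D - phi k1 along b, the
    products of first derivatives cancel, and the integral of the derivative vanishes.\<close>
  have zero: "(\<integral>x. k x * DD b x - \<phi> x * k2 b x \<partial>lborel) = 0" if b: "b \<in> Basis" for b
  proof (rule integral_directional_derivative_eq_0[where g = "\<lambda>x. k x * D b x - \<phi> x * k1 b x" and b = b and R = R])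
    show "((\<lambda>t. k (x + t *\<^sub>R b) * D b (x + t *\<^sub>R b) - \<phi> (x + t *\<^sub>R b) * k1 b (x + t *\<^sub>R b))
        has_real_derivative k x * DD b x - \<phi> x * k2 b x) (at 0)" for x
      using DERIV_diff[OF DERIV_mult[OF dk deriv2] DERIV_mult[OF deriv dk1], of b b b b x x x x] b
      by (simp add: algebra_simps)
    show "continuous_on UNIV (\<lambda>x. k x * D b x - \<phi> x * k1 b x)"
      by (intro continuous_intros ck cont_deriv b cont ck1)
    show "continuous_on UNIV (\<lambda>x. k x * DD b x - \<phi> x * k2 b x)"
      by (intro continuous_intros ck cont_deriv2 b cont ck2)
    show "k x * D b x - \<phi> x * k1 b x = 0" if "R < norm x" for x
      using that b by (simp add: supp supp_deriv)
  qed
  have int: "integrable lborel (\<lambda>x. k x * DD b x - \<phi> x * k2 b x)" if b: "b \<in> Basis" for b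
    by (rule integrable_continuous_bounded_support[where R = R])
       (use b in \<open>auto intro!: continuous_intros ck cont_deriv2 cont ck2 simp: supp supp_deriv2\<close>)
  \<comment> \<open>Summing over the basis leaves the factor |x|^2 - S = -e: away from the pole the
    kernel is harmonic, and only the regularisation survives.\<close>
  have lap_k: "(\<Sum>b\<in>Basis. k2 b x) = - (c * N) * (e * S x powr (- (real N / 2 + 1)))" for x
  proof -
    have sq: "(\<Sum>b\<in>Basis. (x \<bullet> b)\<^sup>2) = (norm x)\<^sup>2"
      by (subst power2_norm_eq_inner, subst euclidean_inner) (simp add: power2_eq_square)
    have "S x powr (- real N / 2) = S x * S x powr (- real N / 2 - 1)"
      using S[of x] powr_add[of "S x" 1 "- real N / 2 - 1"] by simp
    moreover have "(\<Sum>b\<in>Basis. k2 b x) = - c * N * S x powr (- real N / 2)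
        + c * N * S x powr (- real N / 2 - 1) * (norm x)\<^sup>2"
      by (simp add: k2_def sum_subtractf sum.distrib sum_distrib_left[symmetric] sq N_def)
    ultimately have "(\<Sum>b\<in>Basis. k2 b x) = c * N * S x powr (- real N / 2 - 1) * ((norm x)\<^sup>2 - S x)"
      by (simp add: algebra_simps)
    moreover have "- real N / 2 - 1 = - (real N / 2 + 1)" by simp
    ultimately show ?thesis by (simp add: S_def mult_ac)
  qed
  have "0 = (\<Sum>b\<in>Basis. \<integral>x. k x * DD b x - \<phi> x * k2 b x \<partial>lborel)"
    using zero by simp
  also have "\<dots> = (\<integral>x. (\<Sum>b\<in>Basis. k x * DD b x - \<phi> x * k2 b x) \<partial>lborel)"
    using int by (rule Bochner_Integration.integral_sum[symmetric])
  also have "\<dots> = (\<integral>x. k x * Lap x - - (c * N) * (e * S x powr (- (real N / 2 + 1)) * \<phi> x) \<partial>lborel)"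
    by (simp only: sum_subtractf sum_distrib_left[symmetric] lap_k Lap_def) (simp add: mult_ac)
  also have "\<dots> = (\<integral>x. k x * Lap x \<partial>lborel) - (\<integral>x. - (c * N) * (e * S x powr (- (real N / 2 + 1)) * \<phi> x) \<partial>lborel)"
  proof (rule Bochner_Integration.integral_diff)
    show "integrable lborel (\<lambda>x. k x * Lap x)"
      by (rule integrable_continuous_bounded_support[where R = R])
         (auto intro!: continuous_intros ck cont_Lap simp: supp_Lap)
    show "integrable lborel (\<lambda>x. - (c * N) * (e * S x powr (- (real N / 2 + 1)) * \<phi> x))"
      by (rule integrable_continuous_bounded_support[where R = R])
         (auto intro!: continuous_intros cp cont simp: supp)
  qed
  finally show ?thesis
    unfolding k_def S_def c_def N_def integral_mult_right_zero by linarith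
qed


text \<open>Green's identity with e = t^2 and t tending to 0. On the left the regularised kernels
  converge under a fixed majorant; on the right the substitution x -> t x fixes the weight and moves
  t into the argument of \<open>\<phi>\<close>.\<close>

lemma integral_newton_kernel_Lap_0:
  assumes N: "DIM('a) \<ge> 2"
  shows "(\<integral>x. newton_kernel x * Lap x \<partial>lborel)
    = - (newton_const DIM('a) * DIM('a) * unit_ball_vol DIM('a)) * \<phi> 0"
proof -
  define \<tau> where "\<tau> = (\<lambda>n. inverse (real (Suc n)))"
  have \<tau>: "\<tau> n > 0" "\<tau> n \<le> 1" for n by (auto simp: \<tau>_def field_simps)
  have \<tau>_lim: "\<tau> \<longlonglongrightarrow> 0" unfolding \<tau>_def by (rule LIMSEQ_inverse_real_of_nat)
  let ?N = "DIM('a)"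
  let ?P = "\<lambda>x::'a. (1 + (norm x)\<^sup>2) powr (- (real ?N / 2 + 1))"
  have [measurable]: "\<phi> \<in> borel_measurable borel" "Lap \<in> borel_measurable borel"
    using cont cont_Lap by (auto intro: borel_measurable_continuous_onI)
  obtain M where M: "M > 0" "\<And>x. \<bar>Lap x\<bar> \<le> M"
    using bounded_continuous_bounded_support[OF cont_Lap supp_Lap] by blast
  obtain M' where M': "M' > 0" "\<And>x. \<bar>\<phi> x\<bar> \<le> M'"
    using bounded_continuous_bounded_support[OF cont supp] by blast
  define r where "r = max R 1"
  have r: "r > 0" "R \<le> r" by (auto simp: r_def)
  let ?k1 = "\<lambda>x::'a. newton_profile ?N ((norm x)\<^sup>2 + 1)"
  \<comment> \<open>The profile decreases, so every regularised kernel lies between the one with e =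
    1 and the kernel itself; the sum of their absolute values on a ball is the majorant.\<close>
  have "(\<lambda>n. \<integral>x. newton_profile ?N ((norm x)\<^sup>2 + (\<tau> n)\<^sup>2) * Lap x \<partial>lborel) \<longlonglongrightarrow> (\<integral>x. newton_kernel x * Lap x \<partial>lborel)"
  proof (rule integral_dominated_convergence)
    have "continuous_on (cball 0 r) ?k1"
      by (rule continuous_on_compose2[OF continuous_on_newton_profile])
         (auto intro!: continuous_intros simp: add_nonneg_pos)
    then have "integrable lborel (\<lambda>x. indicator (cball 0 r) x *\<^sub>R ?k1 x)"
      by (intro borel_integrable_compact) auto
    then show "integrable lborel (\<lambda>x::'a. M * (\<bar>indicator (cball 0 r) x * newton_kernel x\<bar> + \<bar>indicator (cball 0 r) x *\<^sub>R ?k1 x\<bar>))"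
      by (intro integrable_mult_right Bochner_Integration.integrable_add integrable_abs integrable_newton_kernel_cball N r)
    show "AE x in lborel. norm (newton_profile ?N ((norm x)\<^sup>2 + (\<tau> n)\<^sup>2) * Lap x)
        \<le> M * (\<bar>indicator (cball 0 r) x * newton_kernel x\<bar> + \<bar>indicator (cball 0 r) x *\<^sub>R ?k1 x\<bar>)" for n
      using AE_lborel_singleton[of 0]
    proof eventually_elim
      case (elim x)
      show ?case
      proof (cases "norm x \<le> r")
        case True
        have "newton_profile ?N ((norm x)\<^sup>2 + (\<tau> n)\<^sup>2) \<le> newton_profile ?N ((norm x)\<^sup>2)"
          using elim N by (intro newton_profile_antimono) auto
        moreover have "?k1 x \<le> newton_profile ?N ((norm x)\<^sup>2 + (\<tau> n)\<^sup>2)"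
          using elim N \<tau>[of n] by (intro newton_profile_antimono) (auto simp: power_le_one add_pos_nonneg)
        ultimately have "\<bar>newton_profile ?N ((norm x)\<^sup>2 + (\<tau> n)\<^sup>2)\<bar> \<le> \<bar>newton_kernel x\<bar> + \<bar>?k1 x\<bar>"
          by (auto simp: newton_kernel_def)
        then have "\<bar>newton_profile ?N ((norm x)\<^sup>2 + (\<tau> n)\<^sup>2)\<bar> * \<bar>Lap x\<bar> \<le> (\<bar>newton_kernel x\<bar> + \<bar>?k1 x\<bar>) * M"
          using M by (intro mult_mono) auto
        then show ?thesis using True by (simp add: abs_mult mult.commute)
      qed (use r in \<open>simp add: supp_Lap\<close>)
    qed
    show "AE x in lborel. (\<lambda>n. newton_profile ?N ((norm x)\<^sup>2 + (\<tau> n)\<^sup>2) * Lap x) \<longlonglongrightarrow> newton_kernel x * Lap x"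
      using AE_lborel_singleton[of 0]
    proof eventually_elim
      case (elim x)
      have "isCont (newton_profile ?N) ((norm x)\<^sup>2)"
        using elim by (intro DERIV_isCont[OF DERIV_newton_profile]) auto
      moreover have "(\<lambda>n. (norm x)\<^sup>2 + (\<tau> n)\<^sup>2) \<longlonglongrightarrow> (norm x)\<^sup>2"
        using tendsto_add[OF tendsto_const[of "(norm x)\<^sup>2"] tendsto_power[OF \<tau>_lim, of 2]] by simp
      ultimately have "(\<lambda>n. newton_profile ?N ((norm x)\<^sup>2 + (\<tau> n)\<^sup>2)) \<longlonglongrightarrow> newton_kernel x"
        unfolding newton_kernel_def by (rule isCont_tendsto_compose)
      then show ?case by (intro tendsto_mult tendsto_const)
    qed
  qed auto
  moreover have "(\<integral>x. newton_profile ?N ((norm x)\<^sup>2 + (\<tau> n)\<^sup>2) * Lap x \<partial>lborel)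
      = - (newton_const ?N * ?N) * (\<integral>x. ?P x * \<phi> (\<tau> n *\<^sub>R x) \<partial>lborel)" for n
  proof -
    let ?F = "\<lambda>x::'a. (\<tau> n)\<^sup>2 * ((norm x)\<^sup>2 + (\<tau> n)\<^sup>2) powr (- (real ?N / 2 + 1)) * \<phi> x"
    \<comment> \<open>The powers cancel: N from the Jacobian and 2 from the factor e against -(N +
      2) from the weight.\<close>
    have scaled: "(\<tau> n) ^ ?N * ?F (\<tau> n *\<^sub>R x) = ?P x * \<phi> (\<tau> n *\<^sub>R x)" for x
    proof -
      have "(norm (\<tau> n *\<^sub>R x))\<^sup>2 + (\<tau> n)\<^sup>2 = (\<tau> n)\<^sup>2 * (1 + (norm x)\<^sup>2)"
        by (simp add: power_mult_distrib algebra_simps)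
      then have "((norm (\<tau> n *\<^sub>R x))\<^sup>2 + (\<tau> n)\<^sup>2) powr (- (real ?N / 2 + 1)) =
          ((\<tau> n)\<^sup>2) powr (- (real ?N / 2 + 1)) * ?P x"
        by (simp only: powr_mult zero_le_power2 add_nonneg_nonneg zero_le_one)
      moreover have "(\<tau> n) ^ ?N * (\<tau> n)\<^sup>2 * ((\<tau> n)\<^sup>2) powr (- (real ?N / 2 + 1)) = 1"
      proof -
        have "(\<tau> n) ^ ?N = \<tau> n powr real ?N" and sq: "(\<tau> n)\<^sup>2 = \<tau> n powr 2"
          using \<tau>[of n] by (simp_all add: powr_realpow)
        then have "(\<tau> n) ^ ?N * (\<tau> n)\<^sup>2 * ((\<tau> n)\<^sup>2) powr (- (real ?N / 2 + 1))
            = \<tau> n powr (real ?N + 2 + 2 * (- (real ?N / 2 + 1)))"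
          by (simp only: powr_powr powr_add)
        then show ?thesis using \<tau>(1)[of n] by simp
      qed
      ultimately have "(\<tau> n) ^ ?N * ?F (\<tau> n *\<^sub>R x) = 1 * (?P x * \<phi> (\<tau> n *\<^sub>R x))"
        by (simp only: mult.assoc[symmetric])
      then show ?thesis by (simp only: mult_1_left)
    qed
    have "(\<integral>x. ?F x \<partial>lborel) = (\<tau> n) ^ ?N * (\<integral>x. ?F (\<tau> n *\<^sub>R x) \<partial>lborel)"
      by (rule integral_lborel_scaleR[OF _ \<tau>(1)]) measurable
    also have "\<dots> = (\<integral>x. (\<tau> n) ^ ?N * ?F (\<tau> n *\<^sub>R x) \<partial>lborel)"
      by (rule integral_mult_right_zero[symmetric])
    also have "\<dots> = (\<integral>x. ?P x * \<phi> (\<tau> n *\<^sub>R x) \<partial>lborel)"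
      by (simp only: scaled)
    finally show ?thesis
      using Green_regularised[of "(\<tau> n)\<^sup>2"] \<tau>[of n] by simp
  qed
  moreover have "(\<lambda>n. \<integral>x. ?P x * \<phi> (\<tau> n *\<^sub>R x) \<partial>lborel) \<longlonglongrightarrow> (\<integral>x. ?P x * \<phi> 0 \<partial>lborel)"
  proof (rule integral_dominated_convergence)
    have "integrable lborel ?P"
      using has_bochner_integral_inverse_quadratic_power by (rule integrable.intros)
    then show "integrable lborel (\<lambda>x. ?P x * M')" by (intro integrable_mult_left)
    show "AE x in lborel. norm (?P x * \<phi> (\<tau> n *\<^sub>R x)) \<le> ?P x * M'" for n
      using M' by (intro AE_I2) (auto simp: abs_mult intro!: mult_left_mono)
    show "AE x in lborel. (\<lambda>n. ?P x * \<phi> (\<tau> n *\<^sub>R x)) \<longlonglongrightarrow> ?P x * \<phi> 0"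
    proof (intro AE_I2 tendsto_mult tendsto_const)
      fix x :: 'a
      have "isCont \<phi> 0" using cont by (simp add: continuous_on_eq_continuous_at)
      moreover have "(\<lambda>n. \<tau> n *\<^sub>R x) \<longlonglongrightarrow> 0"
        using tendsto_scaleR[OF \<tau>_lim tendsto_const[of x]] by simp
      ultimately show "(\<lambda>n. \<phi> (\<tau> n *\<^sub>R x)) \<longlonglongrightarrow> \<phi> 0"
        by (rule isCont_tendsto_compose)
    qed
  qed auto
  moreover have "(\<integral>x. ?P x * \<phi> 0 \<partial>lborel) = unit_ball_vol ?N * \<phi> 0"
    using has_bochner_integral_integral_eq[OF has_bochner_integral_inverse_quadratic_power[where 'a='a]] by simp
  ultimately have "(\<lambda>n. \<integral>x. newton_profile ?N ((norm x)\<^sup>2 + (\<tau> n)\<^sup>2) * Lap x \<partial>lborel)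
      \<longlonglongrightarrow> - (newton_const ?N * ?N) * (unit_ball_vol ?N * \<phi> 0)"
    by (simp only:) (intro tendsto_mult tendsto_const)
  then show ?thesis
    using \<open>(\<lambda>n. \<integral>x. newton_profile ?N ((norm x)\<^sup>2 + (\<tau> n)\<^sup>2) * Lap x \<partial>lborel) \<longlonglongrightarrow> (\<integral>x. newton_kernel x * Lap x \<partial>lborel)\<close>
      LIMSEQ_unique by fastforce
qed

end

section \<open>Test functions, kernels with arbitrary pole, and Fubini\<close>

lemma has_real_derivative_along:
  fixes f :: "'a::euclidean_space \<Rightarrow> real"
  assumes "f differentiable (at x)"
  shows "((\<lambda>t. f (x + t *\<^sub>R b)) has_real_derivative partial_deriv b f x) (at 0)"
proof -
  let ?F = "frechet_derivative f (at x)"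
  have F: "(f has_derivative ?F) (at x)"
    using assms by (simp add: frechet_derivative_works)
  have "((\<lambda>t::real. x + t *\<^sub>R b) has_derivative (\<lambda>t. t *\<^sub>R b)) (at 0)"
    by (auto intro!: derivative_eq_intros)
  then have "((\<lambda>t::real. f (x + t *\<^sub>R b)) has_derivative (\<lambda>t. ?F (t *\<^sub>R b))) (at 0)"
    by (rule has_derivative_compose) (simp add: F)
  moreover have "?F (t *\<^sub>R b) = partial_deriv b f x * t" for t
    using has_derivative_linear[OF F] by (simp add: partial_deriv_def linear_cmul)
  ultimately show ?thesis by (simp add: has_field_derivative_def mult_commute_abs)
qed

lemma test_function_C2_bounded_support:
  fixes \<phi> :: "'a::euclidean_space \<Rightarrow> real"
  assumes "test_function \<phi>"
  obtains R where "C2_bounded_support \<phi> (\<lambda>b. partial_deriv b \<phi>) (\<lambda>b. partial_deriv b (partial_deriv b \<phi>)) R"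
proof -
  have "Ck (Suc (Suc 0)) \<phi>" and c: "compact (closure {x. \<phi> x \<noteq> 0})"
    using assms unfolding test_function_def by blast+
  then have d: "\<And>x. \<phi> differentiable (at x)"
    and d2: "\<And>b x. b \<in> Basis \<Longrightarrow> partial_deriv b \<phi> differentiable (at x)"
    and c2: "\<And>b. b \<in> Basis \<Longrightarrow> continuous_on UNIV (partial_deriv b (partial_deriv b \<phi>))"
    by auto
  obtain R where R: "\<And>x. x \<in> closure {x. \<phi> x \<noteq> 0} \<Longrightarrow> norm x \<le> R"
    using compact_imp_bounded[OF c] by (auto simp: bounded_iff)
  have supp: "\<phi> x = 0" if "norm x > R" for x
    using R[of x] that closure_subset[of "{x. \<phi> x \<noteq> 0}"] by fastforce
  have "C2_bounded_support \<phi> (\<lambda>b. partial_deriv b \<phi>) (\<lambda>b. partial_deriv b (partial_deriv b \<phi>)) R"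
  proof
    show "continuous_on UNIV \<phi>"
      using d by (simp add: continuous_on_eq_continuous_at differentiable_imp_continuous_within)
    show "continuous_on UNIV (partial_deriv b \<phi>)" if "b \<in> Basis" for b
      using d2[OF that] by (simp add: continuous_on_eq_continuous_at differentiable_imp_continuous_within)
  qed (use d d2 c2 supp in \<open>auto intro: has_real_derivative_along\<close>)
  with that show ?thesis .
qed

context C2_bounded_support
begin

lemma integrable_newton_kernel_Lap:
  assumes N: "DIM('a) \<ge> 2"
  shows "integrable lborel (\<lambda>x. newton_kernel x * Lap x)"
proof -
  have [measurable]: "Lap \<in> borel_measurable borel"
    using cont_Lap by (rule borel_measurable_continuous_onI)
  obtain M where M: "M > 0" "\<And>x. \<bar>Lap x\<bar> \<le> M"
    using bounded_continuous_bounded_support[OF cont_Lap supp_Lap] by blast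
  define r where "r = max R 1"
  have r: "r > 0" "R \<le> r" by (auto simp: r_def)
  show ?thesis
  proof (rule Bochner_Integration.integrable_bound)
    show "integrable lborel (\<lambda>x::'a. (indicator (cball 0 r) x * newton_kernel x) * M)"
      using integrable_newton_kernel_cball[OF N r(1)] by (rule integrable_mult_left)
    have "norm (newton_kernel x * Lap x) \<le> norm ((indicator (cball 0 r) x * newton_kernel x) * M)" for x
      using M(2)[of x] M(1) r supp_Lap[of x]
      by (cases "norm x \<le> r") (auto simp: abs_mult intro!: mult_left_mono)
    then show "AE x in lborel. norm (newton_kernel x * Lap x) \<le> norm ((indicator (cball 0 r) x * newton_kernel x) * M)"
      by (rule AE_I2)
  qed measurable
qed

lemma translate: "C2_bounded_support (\<lambda>x. \<phi> (x + y)) (\<lambda>b x. D b (x + y)) (\<lambda>b x. DD b (x + y)) (R + norm y)"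
proof
  fix x b :: 'a
  show "((\<lambda>t. \<phi> (x + t *\<^sub>R b + y)) has_real_derivative D b (x + y)) (at 0)" if "b \<in> Basis"
    using deriv[OF that, of "x + y"] by (simp add: algebra_simps)
  show "((\<lambda>t. D b (x + t *\<^sub>R b + y)) has_real_derivative DD b (x + y)) (at 0)" if "b \<in> Basis"
    using deriv2[OF that, of "x + y"] by (simp add: algebra_simps)
  show "continuous_on UNIV (\<lambda>x. \<phi> (x + y))"
    by (intro continuous_on_compose2[OF cont] continuous_intros) auto
  show "continuous_on UNIV (\<lambda>x. D b (x + y))" if "b \<in> Basis"
    by (intro continuous_on_compose2[OF cont_deriv[OF that]] continuous_intros) auto
  show "continuous_on UNIV (\<lambda>x. DD b (x + y))" if "b \<in> Basis"
    by (intro continuous_on_compose2[OF cont_deriv2[OF that]] continuous_intros) auto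
  show "\<phi> (x + y) = 0" if "R + norm y < norm x"
    using that norm_triangle_ineq4[of "x + y" y] by (intro supp) simp
qed

text \<open>Translation moves the pole from y to the origin. Integrability is part of the conclusion
  because the Fubini argument splits an integral of a kernel difference.\<close>

lemma has_bochner_integral_newton_kernel_Lap:
  assumes N: "DIM('a) \<ge> 2"
  shows "has_bochner_integral lborel (\<lambda>x. newton_kernel (x - y) * Lap x)
     (- (newton_const DIM('a) * DIM('a) * unit_ball_vol DIM('a)) * \<phi> y)"
proof -
  interpret T: C2_bounded_support "\<lambda>x. \<phi> (x + y)" "\<lambda>b x. D b (x + y)" "\<lambda>b x. DD b (x + y)" "R + norm y"
    by (rule translate)
  have [measurable]: "Lap \<in> borel_measurable borel"
    using cont_Lap by (rule borel_measurable_continuous_onI)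
  have eq: "(\<lambda>x. newton_kernel x * T.Lap x) = (\<lambda>x. newton_kernel (x + y - y) * Lap (x + y))"
    by (simp add: Lap_def T.Lap_def)
  have "(\<integral>x. newton_kernel (x - y) * Lap x \<partial>lborel) = (\<integral>x. newton_kernel (x + y - y) * Lap (x + y) \<partial>lborel)"
    by (rule integral_lborel_shift[symmetric]) measurable
  then have "(\<integral>x. newton_kernel (x - y) * Lap x \<partial>lborel)
     = - (newton_const DIM('a) * DIM('a) * unit_ball_vol DIM('a)) * \<phi> y"
    using T.integral_newton_kernel_Lap_0[OF N] by (simp add: eq)
  moreover have "integrable (distr lborel borel ((+) y)) (\<lambda>x. newton_kernel (x - y) * Lap x)"
    using T.integrable_newton_kernel_Lap[OF N]
    by (subst integrable_distr_eq) (auto simp: eq add.commute)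
  then have "integrable lborel (\<lambda>x. newton_kernel (x - y) * Lap x)"
    by (simp add: lborel_distr_plus)
  ultimately show ?thesis by (simp add: has_bochner_integral_iff)
qed

text \<open>The kernel difference makes the double integral absolutely convergent, and a bound on
  the ball that supports the Laplacian suffices. After the exchange the inner integral splits, since
  y is fixed, and its reference term vanishes.\<close>

lemma integral_newton_kernel_Lap_Fubini:
  assumes N: "DIM('a) \<ge> 2" and [measurable]: "f \<in> borel_measurable borel"
    and bound: "\<And>x. norm x \<le> R \<Longrightarrow>
      (\<integral>\<^sup>+ y. ennreal \<bar>f y * (newton_kernel (x - y) - newton_kernel (0 - y))\<bar> \<partial>lborel) \<le> ennreal M"
  shows "(\<integral>x. (\<integral>y. f y * (newton_kernel (x - y) - newton_kernel (0 - y)) \<partial>lborel) * Lap x \<partial>lborel)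
    = - (newton_const DIM('a) * DIM('a) * unit_ball_vol DIM('a)) * (\<integral>y. f y * \<phi> y \<partial>lborel)"
proof -
  let ?c = "newton_const DIM('a) * DIM('a) * unit_ball_vol DIM('a)"
  let ?K = "\<lambda>x y. newton_kernel (x - y) - newton_kernel (0 - y) :: real"
  have [measurable]: "Lap \<in> borel_measurable borel"
    using cont_Lap by (rule borel_measurable_continuous_onI)
  have Lap_int: "integrable lborel Lap"
    by (rule integrable_continuous_bounded_support[OF cont_Lap supp_Lap])
  define H where "H = (\<lambda>x y. f y * ?K x y * Lap x)"
  have [measurable]: "case_prod H \<in> borel_measurable (lborel \<Otimes>\<^sub>M lborel)"
    unfolding H_def by measurable
  have "integrable (lborel \<Otimes>\<^sub>M lborel) (case_prod H)"
  proof (rule integrableI_bounded)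
    have "(\<integral>\<^sup>+ z. ennreal (norm (case_prod H z)) \<partial>(lborel \<Otimes>\<^sub>M lborel)) = (\<integral>\<^sup>+ x. \<integral>\<^sup>+ y. ennreal (norm (H x y)) \<partial>lborel \<partial>lborel)"
      by (subst lborel.nn_integral_fst[symmetric]) auto
    also have "\<dots> \<le> (\<integral>\<^sup>+ x. ennreal M * ennreal (norm (Lap x)) \<partial>lborel)"
    proof (intro nn_integral_mono)
      fix x :: 'a
      have "(\<integral>\<^sup>+ y. ennreal (norm (H x y)) \<partial>lborel) = (\<integral>\<^sup>+ y. ennreal \<bar>f y * ?K x y\<bar> * ennreal (norm (Lap x)) \<partial>lborel)"
        by (simp add: H_def abs_mult ennreal_mult)
      also have "\<dots> = (\<integral>\<^sup>+ y. ennreal \<bar>f y * ?K x y\<bar> \<partial>lborel) * ennreal (norm (Lap x))"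
        by (subst nn_integral_multc) auto
      also have "\<dots> \<le> ennreal M * ennreal (norm (Lap x))"
        using bound[of x] supp_Lap[of x] by (cases "norm x \<le> R") (auto intro!: mult_right_mono)
      finally show "(\<integral>\<^sup>+ y. ennreal (norm (H x y)) \<partial>lborel) \<le> ennreal M * ennreal (norm (Lap x))" .
    qed
    also have "\<dots> = ennreal M * (\<integral>\<^sup>+ x. ennreal (norm (Lap x)) \<partial>lborel)"
      by (subst nn_integral_cmult) auto
    also have "\<dots> < \<infinity>"
      using Lap_int by (auto simp: integrable_iff_bounded ennreal_mult_less_top)
    finally show "(\<integral>\<^sup>+ z. ennreal (norm (case_prod H z)) \<partial>(lborel \<Otimes>\<^sub>M lborel)) < \<infinity>" .
  qed simp
  then have "(\<integral>y. \<integral>x. H x y \<partial>lborel \<partial>lborel) = (\<integral>x. \<integral>y. H x y \<partial>lborel \<partial>lborel)"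
    by (rule lborel_pair.Fubini_integral)
  moreover have "(\<integral>y. H x y \<partial>lborel) = (\<integral>y. f y * ?K x y \<partial>lborel) * Lap x" for x
    by (simp add: H_def)
  moreover have "(\<integral>x. H x y \<partial>lborel) = - ?c * (f y * \<phi> y)" for y
  proof -
    have K: "has_bochner_integral lborel (\<lambda>x. newton_kernel (x - y) * Lap x) (- ?c * \<phi> y)"
      by (rule has_bochner_integral_newton_kernel_Lap[OF N])
    have "(\<integral>x. H x y \<partial>lborel) = (\<integral>x. f y * (newton_kernel (x - y) * Lap x - newton_kernel (0 - y) * Lap x) \<partial>lborel)"
      by (simp add: H_def algebra_simps)
    also have "\<dots> = f y * ((\<integral>x. newton_kernel (x - y) * Lap x \<partial>lborel) - (\<integral>x. newton_kernel (0 - y) * Lap x \<partial>lborel))"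
      using K Lap_int by (subst integral_mult_right_zero, subst Bochner_Integration.integral_diff)
         (auto simp: has_bochner_integral_iff)
    also have "\<dots> = - ?c * (f y * \<phi> y)"
      using K integral_Lap by (simp add: has_bochner_integral_iff)
    finally show ?thesis .
  qed
  ultimately show ?thesis by simp
qed

end

section \<open>Newtonian potentials\<close>

text \<open>N times the volume of the unit ball is the area of the unit sphere, so the prefactor
  turns k into the fundamental solution of the negative Laplacian.\<close>

definition newton_potential :: "('a::euclidean_space \<Rightarrow> real) \<Rightarrow> 'a \<Rightarrow> real" where
  "newton_potential f x = 1 / (newton_const DIM('a) * DIM('a) * unit_ball_vol DIM('a)) *
     (\<integral>y. f y * (newton_kernel (x - y) - newton_kernel (0 - y)) \<partial>lborel)"

text \<open>The abstract modulus \<open>m\<close> lets one argument serve both regimes. In the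
  difference of two values the reference term at 0 cancels.\<close>

lemma newton_potential_diff_le:
  fixes f :: "'a::euclidean_space \<Rightarrow> real"
  assumes N: "DIM('a) \<ge> 2" and [measurable]: "f \<in> borel_measurable borel"
    and bound: "\<And>x z. (\<integral>\<^sup>+ y. ennreal \<bar>f y * (newton_kernel (x - y) - newton_kernel (z - y))\<bar> \<partial>lborel) \<le> ennreal (m x z)"
    and m: "\<And>x z. m x z \<ge> 0"
  shows "integrable lborel (\<lambda>y. f y * (newton_kernel (x - y) - newton_kernel (z - y)))"
    and "\<bar>newton_potential f x - newton_potential f z\<bar>
       \<le> 1 / (newton_const DIM('a) * DIM('a) * unit_ball_vol DIM('a)) * m x z"
proof -
  let ?\<kappa> = "1 / (newton_const DIM('a) * DIM('a) * unit_ball_vol DIM('a))"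
  have \<kappa>: "?\<kappa> \<ge> 0" using newton_const_pos[OF N] by simp
  have int: "integrable lborel (\<lambda>y. f y * (newton_kernel (x - y) - newton_kernel (z - y)))" for x z
    using bound[of x z] by (intro integrableI_bounded) (auto simp: le_less_trans[OF _ ennreal_less_top])
  show "integrable lborel (\<lambda>y. f y * (newton_kernel (x - y) - newton_kernel (z - y)))" by (rule int)
  have "(\<integral>y. f y * (newton_kernel (x - y) - newton_kernel (0 - y)) \<partial>lborel) - (\<integral>y. f y * (newton_kernel (z - y) - newton_kernel (0 - y)) \<partial>lborel)
     = (\<integral>y. f y * (newton_kernel (x - y) - newton_kernel (z - y)) \<partial>lborel)"
    by (subst Bochner_Integration.integral_diff[symmetric, OF int int]) (simp add: algebra_simps)
  then have "newton_potential f x - newton_potential f z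
      = ?\<kappa> * (\<integral>y. f y * (newton_kernel (x - y) - newton_kernel (z - y)) \<partial>lborel)"
    unfolding newton_potential_def by (simp only: right_diff_distrib[symmetric])
  moreover have "ennreal \<bar>\<integral>y. f y * (newton_kernel (x - y) - newton_kernel (z - y)) \<partial>lborel\<bar> \<le> ennreal (m x z)"
    using integral_norm_bound_ennreal[OF int, of x z] bound[of x z] by (auto intro: order_trans)
  then have "\<bar>\<integral>y. f y * (newton_kernel (x - y) - newton_kernel (z - y)) \<partial>lborel\<bar> \<le> m x z"
    using m by (simp add: ennreal_le_iff)
  ultimately show "\<bar>newton_potential f x - newton_potential f z\<bar> \<le> ?\<kappa> * m x z"
    using \<kappa> by (simp only: abs_mult abs_of_nonneg mult_left_mono)
qed

text \<open>The potential vanishes at the origin, so the difference estimate with z = 0 bounds its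
  size on bounded sets.\<close>

lemma locally_integrable_newton_potential:
  fixes f :: "'a::euclidean_space \<Rightarrow> real"
  assumes N: "DIM('a) \<ge> 2" and f [measurable]: "f \<in> borel_measurable borel"
    and bound: "\<And>x z. (\<integral>\<^sup>+ y. ennreal \<bar>f y * (newton_kernel (x - y) - newton_kernel (z - y))\<bar> \<partial>lborel) \<le> ennreal (m x z)"
    and m: "\<And>x z. m x z \<ge> 0" and loc: "\<And>r. \<exists>M. \<forall>x. norm x \<le> r \<longrightarrow> m x 0 \<le> M"
  shows "locally_integrable (newton_potential f)"
    and "newton_potential f \<in> borel_measurable borel"
proof -
  let ?\<kappa> = "1 / (newton_const DIM('a) * DIM('a) * unit_ball_vol DIM('a))"
  have \<kappa>: "?\<kappa> \<ge> 0" using newton_const_pos[OF N] by simp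
  show meas [measurable]: "newton_potential f \<in> borel_measurable borel"
    unfolding newton_potential_def[abs_def] by measurable
  have "integrable lborel (\<lambda>x. indicat_real K x *\<^sub>R newton_potential f x)" if K: "compact K" for K
  proof -
    obtain r where r: "\<And>x. x \<in> K \<Longrightarrow> norm x \<le> r"
      using compact_imp_bounded[OF K] by (auto simp: bounded_iff)
    obtain M where M: "\<And>x. norm x \<le> r \<Longrightarrow> m x 0 \<le> M" using loc by blast
    have [measurable]: "K \<in> sets borel" using K by (simp add: compact_imp_closed)
    show ?thesis
    proof (rule Bochner_Integration.integrable_bound)
      show "integrable lborel (\<lambda>x. ?\<kappa> * M * indicat_real K x)"
        using emeasure_compact_finite[OF K] K by (intro integrable_mult_right integrable_real_indicator) auto
      have "norm (indicat_real K x *\<^sub>R newton_potential f x) \<le> norm (?\<kappa> * M * indicat_real K x)" for x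
      proof (cases "x \<in> K")
        case True
        have "newton_potential f 0 = 0" by (simp add: newton_potential_def)
        then have "\<bar>newton_potential f x\<bar> \<le> ?\<kappa> * m x 0"
          using newton_potential_diff_le(2)[OF N f bound m, of x 0] by simp
        also have "\<dots> \<le> ?\<kappa> * M" using M[OF r[OF True]] \<kappa> by (rule mult_left_mono)
        also have "\<dots> \<le> \<bar>?\<kappa> * M\<bar>" by (rule abs_ge_self)
        finally show ?thesis
          using True by (simp only: indicator_simps scaleR_one mult_1_right real_norm_def)
      qed simp
      then show "AE x in lborel. norm (indicat_real K x *\<^sub>R newton_potential f x) \<le> norm (?\<kappa> * M * indicat_real K x)"
        by (rule AE_I2)
    qed measurable
  qed
  then show "locally_integrable (newton_potential f)"
    unfolding locally_integrable_def set_integrable_def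
    by (auto simp: integrable_completion compact_imp_closed)
qed

lemma newton_potential_poisson:
  fixes f :: "'a::euclidean_space \<Rightarrow> real"
  assumes N: "DIM('a) \<ge> 2" and f [measurable]: "f \<in> borel_measurable borel"
    and bound: "\<And>x z. (\<integral>\<^sup>+ y. ennreal \<bar>f y * (newton_kernel (x - y) - newton_kernel (z - y))\<bar> \<partial>lborel) \<le> ennreal (m x z)"
    and m: "\<And>x z. m x z \<ge> 0" and loc: "\<And>r. \<exists>M. \<forall>x. norm x \<le> r \<longrightarrow> m x 0 \<le> M"
    and \<phi>: "test_function \<phi>"
  shows "- (\<integral>x. newton_potential f x * laplacian \<phi> x \<partial>lborel) = (\<integral>x. f x * \<phi> x \<partial>lborel)"
    and "laplacian \<phi> \<in> borel_measurable borel" and "\<phi> \<in> borel_measurable borel"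
proof -
  obtain R where "C2_bounded_support \<phi> (\<lambda>b. partial_deriv b \<phi>) (\<lambda>b. partial_deriv b (partial_deriv b \<phi>)) R"
    using test_function_C2_bounded_support[OF \<phi>] .
  then interpret T: C2_bounded_support \<phi> "\<lambda>b. partial_deriv b \<phi>" "\<lambda>b. partial_deriv b (partial_deriv b \<phi>)" R .
  have Lap: "T.Lap = laplacian \<phi>" by (simp add: fun_eq_iff T.Lap_def laplacian_def)
  show "laplacian \<phi> \<in> borel_measurable borel" "\<phi> \<in> borel_measurable borel"
    using T.cont_Lap T.cont by (auto simp: Lap intro: borel_measurable_continuous_onI)
  let ?c = "newton_const DIM('a) * DIM('a) * unit_ball_vol DIM('a)"
  have c: "?c > 0" using newton_const_pos[OF N] by simp
  obtain M where M: "\<And>x. norm x \<le> R \<Longrightarrow> m x 0 \<le> M" using loc by blast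
  have "(\<integral>x. (\<integral>y. f y * (newton_kernel (x - y) - newton_kernel (0 - y)) \<partial>lborel) * T.Lap x \<partial>lborel)
    = - ?c * (\<integral>y. f y * \<phi> y \<partial>lborel)"
    using M bound by (intro T.integral_newton_kernel_Lap_Fubini[OF N f, of M]) (meson order_trans ennreal_leI)
  moreover have "(\<integral>x. newton_potential f x * laplacian \<phi> x \<partial>lborel) =
     1 / ?c * (\<integral>x. (\<integral>y. f y * (newton_kernel (x - y) - newton_kernel (0 - y)) \<partial>lborel) * T.Lap x \<partial>lborel)"
    unfolding newton_potential_def Lap mult.assoc by (rule integral_mult_right_zero)
  moreover have "1 / C * (- C * I) = - I" if "C > 0" for C I :: real
    using that by simp
  ultimately show "- (\<integral>x. newton_potential f x * laplacian \<phi> x \<partial>lborel) = (\<integral>x. f x * \<phi> x \<partial>lborel)"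
    using c by (simp only: minus_minus)
qed

section \<open>Identification of the modified potentials with the Newton potential\<close>

lemma newton_profile_eq_inverse_power:
  assumes "r \<ge> 0" "N \<ge> 2" "N \<noteq> 2"
  shows "newton_profile N (r\<^sup>2) = 1 / r ^ (N - 2)"
proof (cases "r = 0")
  \<comment> \<open>Both sides take their default value 0: zero to any real power is 0, and division
    by 0 gives 0.\<close>
  case True
  with assms show ?thesis by (simp add: newton_profile_def)
next
  case False
  with assms have "r > 0" by simp
  have "newton_profile N (r\<^sup>2) = (r powr 2) powr (- (real N - 2) / 2)"
    using assms \<open>r > 0\<close> by (simp add: newton_profile_def)
  also have "\<dots> = r powr (- real (N - 2))"
  proof -
    have "2 * (- (real N - 2) / 2) = - real (N - 2)"
      using assms by (simp add: of_nat_diff)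
    then show ?thesis by (simp only: powr_powr)
  qed
  also have "\<dots> = 1 / r ^ (N - 2)"
    using \<open>r > 0\<close> by (simp add: powr_minus_divide powr_realpow)
  finally show ?thesis .
qed

lemma newton_profile_2: "r \<ge> 0 \<Longrightarrow> newton_profile 2 (r\<^sup>2) = ln (1 / r)"
  by (cases "r = 0") (simp_all add: newton_profile_def ln_div ln_realpow)

lemma riesz_integrand_eq:
  assumes "CARD('n::finite) \<ge> 2" "CARD('n) \<noteq> 2"
  shows "riesz_integrand f x y = f y * (newton_kernel (x - y) - newton_kernel (0 - y :: real^'n))"
  using assms by (simp add: riesz_integrand_def newton_kernel_def newton_profile_eq_inverse_power)

lemma log_integrand_eq:
  assumes "CARD('n::finite) = 2"
  shows "log_integrand f x y = f y * (newton_kernel (x - y) - newton_kernel (0 - y :: real^'n))"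
  using assms by (simp add: log_integrand_def newton_kernel_def newton_profile_2 mult.commute)

text \<open>With z = (N - 2)/2, the functional equation applied twice puts z (z + 1) Gamma(z) into
  the denominator of the ball volume, and the factor c N = 4 z (z + 1) cancels all but
  Gamma(z).\<close>

lemma riesz_const_eq:
  assumes "N > 2"
  shows "riesz_const N = 1 / (newton_const N * N * unit_ball_vol N)"
proof -
  define z where "z = (real N - 2) / 2"
  have z: "z > 0" and N: "real N = 2 * z + 2" using assms by (simp_all add: z_def field_simps)
  have "Gamma (x + 1) = x * Gamma x" if "x > 0" for x :: real
    using that by (intro Gamma_plus1) (auto elim!: nonpos_Ints_cases)
  from this[of "z + 1"] this[of z] have "Gamma (z + 1 + 1) = (z + 1) * (z * Gamma z)"
    using z by simp
  moreover have "real N / 2 + 1 = z + 1 + 1" by (simp add: N)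
  ultimately have G: "Gamma (real N / 2 + 1) = (z + 1) * (z * Gamma z)" by (simp only:)
  have "Gamma z > 0" using z by (rule Gamma_real_pos)
  moreover have "newton_const N = 2 * z" using assms by (simp add: newton_const_def z_def)
  moreover have "riesz_const N = Gamma z / (4 * pi powr (real N / 2))"
    by (simp add: riesz_const_def z_def)
  moreover have "2 * z * (2 * z + 2) * (P / ((z + 1) * (z * g))) = 4 * P / g" if "g > 0" for P g :: real
  proof -
    have "2 * z * (2 * z + 2) * (P / ((z + 1) * (z * g))) = (4 * P * ((z + 1) * z)) / (g * ((z + 1) * z))"
      by (simp add: algebra_simps add_divide_distrib)
    also have "\<dots> = 4 * P / g" using z by (intro mult_divide_mult_cancel_right) auto
    finally show ?thesis .
  qed
  ultimately show ?thesis
    unfolding unit_ball_vol_def G by (simp only: N) simp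
qed

text \<open>Since f is only Lebesgue measurable, the bridge replaces it by an almost everywhere
  equal Borel function; integrals and integrability over the completion then agree with those over
  \<open>lborel\<close>.\<close>

lemma I2_tilde_eq:
  fixes f :: "real^'n::finite \<Rightarrow> real"
  assumes N: "CARD('n) \<ge> 2" and [measurable]: "g \<in> borel_measurable borel" "f \<in> borel_measurable lebesgue"
    and ae: "AE y in lborel. f y = g y"
  shows "I2_tilde f x = newton_potential g x"
    and "I2_tilde_defined f x \<longleftrightarrow> integrable lborel (\<lambda>y. g y * (newton_kernel (x - y) - newton_kernel (0 - y)))"
proof -
  let ?K = "\<lambda>y::real^'n. newton_kernel (x - y) - newton_kernel (0 - y)"
  have [measurable]: "?K \<in> borel_measurable borel" by measurable
  have K [measurable]: "?K \<in> borel_measurable lebesgue" by (rule measurable_completion) simp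
  have gK: "(\<lambda>y. g y * ?K y) \<in> borel_measurable lborel" by simp
  have fK: "(\<lambda>y. f y * ?K y) \<in> borel_measurable lebesgue"
    by (intro borel_measurable_times K) fact
  have gK': "(\<lambda>y. g y * ?K y) \<in> borel_measurable lebesgue" using gK by (rule measurable_completion)
  have ae': "AE y in lebesgue. f y * ?K y = g y * ?K y"
    using ae by (intro AE_completion) (auto elim!: eventually_mono)
  have int: "(\<integral>y. f y * ?K y \<partial>lebesgue) = (\<integral>y. g y * ?K y \<partial>lborel)"
    using integral_cong_AE[OF fK gK' ae'] integral_completion[OF gK] by simp
  have defd: "integrable lebesgue (\<lambda>y. f y * ?K y) \<longleftrightarrow> integrable lborel (\<lambda>y. g y * ?K y)"
    using integrable_cong_AE[OF fK gK' ae'] integrable_completion[OF gK] by simp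
  have vol2: "unit_ball_vol 2 = pi" by (simp add: unit_ball_vol_def Gamma_numeral)
  have logK: "log_integrand f x = (\<lambda>y. f y * ?K y)" if "CARD('n) = 2"
    using log_integrand_eq[OF that] by (intro ext)
  have rieszK: "riesz_integrand f x = (\<lambda>y. f y * ?K y)" if "CARD('n) \<noteq> 2"
    using riesz_integrand_eq[OF N that] by (intro ext)
  show "I2_tilde f x = newton_potential g x"
  proof (cases "CARD('n) = 2")
    case True
    then show ?thesis
      using int by (simp add: I2_tilde_def logK newton_potential_def newton_const_def vol2)
  next
    case False
    then show ?thesis
      using int N by (simp add: I2_tilde_def rieszK newton_potential_def riesz_const_eq)
  qed
  show "I2_tilde_defined f x \<longleftrightarrow> integrable lborel (\<lambda>y. g y * ?K y)"
    unfolding I2_tilde_defined_def using defd by (simp add: logK rieszK del: diff_0)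
qed

section \<open>Functions in L^p and their Borel representatives\<close>

lemma Lp_nn_integral:
  assumes f: "f \<in> Lp p" and ae: "AE y in lborel. f y = g y"
  shows "(\<integral>\<^sup>+ y. ennreal (\<bar>g y\<bar> powr p) \<partial>lborel) = ennreal (\<integral>y. \<bar>f y\<bar> powr p \<partial>lebesgue)"
proof -
  have "ennreal (\<integral>y. \<bar>f y\<bar> powr p \<partial>lebesgue) = (\<integral>\<^sup>+ y. ennreal (\<bar>f y\<bar> powr p) \<partial>lebesgue)"
    using f by (intro nn_integral_eq_integral[symmetric]) (auto simp: Lp_def)
  also have "\<dots> = (\<integral>\<^sup>+ y. ennreal (\<bar>f y\<bar> powr p) \<partial>lborel)" by (rule nn_integral_completion)
  also have "\<dots> = (\<integral>\<^sup>+ y. ennreal (\<bar>g y\<bar> powr p) \<partial>lborel)"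
    using ae by (intro nn_integral_cong_AE) (auto elim!: eventually_mono)
  finally show ?thesis by simp
qed

lemma Lp_borel_representative:
  assumes "f \<in> Lp p"
  obtains g where "g \<in> borel_measurable borel" "AE y in lborel. f y = g y"
  using assms completion_ex_borel_measurable_real[of f lborel] that by (auto simp: Lp_def)

lemma Lp_locally_integrable:
  fixes f :: "'a::euclidean_space \<Rightarrow> real"
  assumes f: "f \<in> Lp p" and p: "p \<ge> 1"
  shows "locally_integrable f"
  unfolding locally_integrable_def
proof (intro allI impI)
  fix K :: "'a set" assume K: "compact K"
  have [measurable]: "f \<in> borel_measurable lebesgue" and int: "integrable lebesgue (\<lambda>y. \<bar>f y\<bar> powr p)"
    using f by (auto simp: Lp_def)
  have Ks [measurable]: "K \<in> sets lebesgue" using K by (simp add: compact_imp_closed)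
  have le: "\<bar>f y\<bar> \<le> 1 + \<bar>f y\<bar> powr p" for y
  proof (cases "\<bar>f y\<bar> \<le> 1")
    case False
    then have "\<bar>f y\<bar> powr 1 \<le> \<bar>f y\<bar> powr p" using p by (intro powr_mono) auto
    with False show ?thesis by simp
  qed (simp add: add_increasing2)
  show "set_integrable lebesgue K f"
    unfolding set_integrable_def
  proof (rule Bochner_Integration.integrable_bound)
    show "integrable lebesgue (\<lambda>y. indicat_real K y + \<bar>f y\<bar> powr p)"
      using int emeasure_compact_finite[OF K] K
      by (intro Bochner_Integration.integrable_add integrable_real_indicator) (auto simp: compact_imp_closed)
    show "AE y in lebesgue. norm (indicat_real K y *\<^sub>R f y) \<le> norm (indicat_real K y + \<bar>f y\<bar> powr p)"
      using le by (intro AE_I2) (auto split: split_indicator)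
  qed measurable
qed

section \<open>Regularity and Poisson's equation for the modified potential\<close>

lemma I2_tilde_regularity:
  fixes f g :: "real^'n::finite \<Rightarrow> real"
  assumes N: "CARD('n) \<ge> 2" and g: "g \<in> borel_measurable borel" and f: "f \<in> borel_measurable lebesgue"
    and ae: "AE y in lborel. f y = g y"
    and bound: "\<And>x z. (\<integral>\<^sup>+ y. ennreal \<bar>g y * (newton_kernel (x - y) - newton_kernel (z - y))\<bar> \<partial>lborel) \<le> ennreal (m x z)"
    and m: "\<And>x z. m x z \<ge> 0"
  shows "\<bar>I2_tilde f x - I2_tilde f z\<bar> \<le> 1 / (newton_const CARD('n) * CARD('n) * unit_ball_vol CARD('n)) * m x z"
  using newton_potential_diff_le(2)[OF _ g bound m, of x z] N by (simp add: I2_tilde_eq(1)[OF N g f ae])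

lemma I2_tilde_poisson:
  fixes f g :: "real^'n::finite \<Rightarrow> real"
  assumes N: "CARD('n) \<ge> 2" and g: "g \<in> borel_measurable borel" and f: "f \<in> borel_measurable lebesgue"
    and ae: "AE y in lborel. f y = g y" and locf: "locally_integrable f"
    and bound: "\<And>x z. (\<integral>\<^sup>+ y. ennreal \<bar>g y * (newton_kernel (x - y) - newton_kernel (z - y))\<bar> \<partial>lborel) \<le> ennreal (m x z)"
    and m: "\<And>x z. m x z \<ge> 0" and loc: "\<And>r. \<exists>M. \<forall>x. norm x \<le> r \<longrightarrow> m x 0 \<le> M"
  shows "(\<forall>x. I2_tilde_defined f x) \<and> distributional_poisson_solution (I2_tilde f) f"
proof
  have D: "DIM(real^'n) \<ge> 2" using N by simp
  show "\<forall>x. I2_tilde_defined f x"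
    using newton_potential_diff_le(1)[OF D g bound m] by (simp add: I2_tilde_eq(2)[OF N g f ae] del: diff_0)
  have u: "I2_tilde f = newton_potential g" using I2_tilde_eq(1)[OF N g f ae] by (intro ext)
  have um: "newton_potential g \<in> borel_measurable borel"
    by (rule locally_integrable_newton_potential(2)[OF D g bound m loc])
  show "distributional_poisson_solution (I2_tilde f) f"
    unfolding distributional_poisson_solution_def u
  proof (intro conjI allI impI locf)
    show "locally_integrable (newton_potential g)"
      by (rule locally_integrable_newton_potential(1)[OF D g bound m loc])
    fix \<phi> :: "real^'n \<Rightarrow> real" assume \<phi>: "test_function \<phi>"
    note P = newton_potential_poisson[OF D g bound m loc \<phi>]
    note [measurable] = P(2,3) um g f
    have "(\<integral>x. newton_potential g x * laplacian \<phi> x \<partial>lebesgue) = (\<integral>x. newton_potential g x * laplacian \<phi> x \<partial>lborel)"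
      by (rule integral_completion) measurable
    moreover have "(\<integral>x. f x * \<phi> x \<partial>lebesgue) = (\<integral>x. g x * \<phi> x \<partial>lebesgue)"
    proof (rule integral_cong_AE)
      have \<phi>m: "\<phi> \<in> borel_measurable lebesgue" using P(3) by (intro measurable_completion) simp
      have "g \<in> borel_measurable lebesgue" using g by (intro measurable_completion) simp
      with \<phi>m f show "(\<lambda>x. f x * \<phi> x) \<in> borel_measurable lebesgue" "(\<lambda>x. g x * \<phi> x) \<in> borel_measurable lebesgue"
        by (simp_all add: borel_measurable_times)
      show "AE x in lebesgue. f x * \<phi> x = g x * \<phi> x"
        using ae by (intro AE_completion) (auto elim!: eventually_mono)
    qed
    moreover have "(\<integral>x. g x * \<phi> x \<partial>lebesgue) = (\<integral>x. g x * \<phi> x \<partial>lborel)"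
      by (rule integral_completion) measurable
    ultimately show "- (\<integral>x. newton_potential g x * laplacian \<phi> x \<partial>lebesgue) = (\<integral>x. f x * \<phi> x \<partial>lebesgue)"
      using P(1) by simp
  qed
qed

text \<open>The logarithm blows up at t = 0, but t ln t does not. This crude bound supplies the
  local boundedness of the modulus in the case p = N.\<close>

lemma log_Lipschitz_modulus_le:
  fixes t r a :: real
  assumes "0 \<le> t" "t \<le> r" "a \<le> 1"
  shows "t * (\<bar>ln t\<bar> + 1) powr a \<le> 1 + r + r\<^sup>2"
proof (cases "t = 0")
  case False
  with assms have "t > 0" by simp
  have "t * (\<bar>ln t\<bar> + 1) powr a \<le> t * (\<bar>ln t\<bar> + 1) powr 1"
    using assms by (intro mult_left_mono powr_mono) auto
  also have "\<dots> = t * \<bar>ln t\<bar> + t" by (simp add: distrib_left)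
  finally have "t * (\<bar>ln t\<bar> + 1) powr a \<le> t * \<bar>ln t\<bar> + t" .
  moreover have "t * \<bar>ln t\<bar> \<le> 1 + t\<^sup>2"
  proof (cases "t \<le> 1")
    case True
    have "- ln t = ln (1 / t)" using \<open>t > 0\<close> by (simp add: ln_div)
    also have "\<dots> \<le> 1 / t - 1" using \<open>t > 0\<close> by (intro ln_le_minus_one) simp
    finally have "t * \<bar>ln t\<bar> \<le> t * (1 / t - 1)"
      using \<open>t > 0\<close> True by (intro mult_left_mono) auto
    also have "\<dots> \<le> 1 + t\<^sup>2" using \<open>t > 0\<close> by (simp add: algebra_simps add_increasing2)
    finally show ?thesis .
  next
    case False
    have "t * \<bar>ln t\<bar> \<le> t * t"
      using False ln_le_minus_one[of t] by (intro mult_left_mono) auto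
    then show ?thesis by (simp add: power2_eq_square)
  qed
  moreover have "t\<^sup>2 \<le> r\<^sup>2" using assms by (intro power_mono)
  ultimately show ?thesis using assms by linarith
qed (use assms in \<open>simp add: add_nonneg_nonneg\<close>)

theorem theoremC:
  fixes p :: real
  assumes "CARD('n::finite) \<ge> 2"
    and "real CARD('n) / 2 < p" and "p \<le> real CARD('n)"
  shows
    "(\<forall>f :: real^'n \<Rightarrow> real.
        (p < real CARD('n) \<and> f \<in> Lp p) \<or>
        (p = real CARD('n) \<and> (\<exists>q. 1 < q \<and> q < real CARD('n) \<and> f \<in> Lp (real CARD('n)) \<inter> Lp q))
        \<longrightarrow> (\<forall>x. I2_tilde_defined f x) \<and> distributional_poisson_solution (I2_tilde f) f)
     \<and>
     (p < real CARD('n) \<longrightarrow>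
        (\<exists>C. \<forall>f :: real^'n \<Rightarrow> real. f \<in> Lp p \<longrightarrow>
           (\<forall>x z. \<bar>I2_tilde f x - I2_tilde f z\<bar>
              \<le> C * norm (x - z) powr (2 - real CARD('n) / p) * Lp_norm p f)))
     \<and>
     (p = real CARD('n) \<longrightarrow>
        (\<forall>q. 1 < q \<and> q < real CARD('n) \<longrightarrow>
          (\<exists>C. \<forall>f :: real^'n \<Rightarrow> real. f \<in> Lp (real CARD('n)) \<inter> Lp q \<longrightarrow>
             (\<forall>x z. \<bar>I2_tilde f x - I2_tilde f z\<bar>
                \<le> C * norm (x - z)
                    * (\<bar>ln (norm (x - z))\<bar> + 1) powr
                        (1 / (real CARD('n) / (real CARD('n) - 1)))
                    * (Lp_norm (real CARD('n)) f + Lp_norm q f)))))"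
proof -
  let ?N = "real CARD('n)"
  let ?\<kappa> = "1 / (newton_const CARD('n) * CARD('n) * unit_ball_vol CARD('n))"
  let ?e = "1 / (?N / (?N - 1))"
  have D: "DIM(real^'n) \<ge> 2" using assms by simp
  have p: "p \<ge> 1" using assms by linarith
  have e: "?e \<le> 1" by simp
  \<comment> \<open>Solvability and estimate are proved together, since both follow from the same
    modulus \<open>m\<close>.\<close>
  have Holder: "\<exists>C\<ge>0. \<forall>f :: real^'n \<Rightarrow> real. f \<in> Lp p \<longrightarrow>
      ((\<forall>x. I2_tilde_defined f x) \<and> distributional_poisson_solution (I2_tilde f) f) \<and>
      (\<forall>x z. \<bar>I2_tilde f x - I2_tilde f z\<bar> \<le> ?\<kappa> * (C * norm (x - z) powr (2 - ?N / p) * Lp_norm p f))"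
    if "p < ?N"
  proof -
    have "\<exists>C\<ge>0. \<forall>(g :: real^'n \<Rightarrow> real) A x z. g \<in> borel_measurable borel \<longrightarrow> A \<ge> 0 \<longrightarrow>
       (\<integral>\<^sup>+ y. ennreal (\<bar>g y\<bar> powr p) \<partial>lborel) \<le> ennreal A \<longrightarrow>
       (\<integral>\<^sup>+ y. ennreal \<bar>g y * (newton_kernel (x - y) - newton_kernel (z - y))\<bar> \<partial>lborel)
         \<le> ennreal (C * norm (x - z) powr (2 - ?N / p) * A powr (1 / p))"
      using newton_kernel_potential_Holder_estimate[where 'a="real^'n" and p = p, OF D] assms(2) that
      by (simp only: DIM_cart DIM_real mult_1_right)
    then obtain C where "C \<ge> 0" and C: "\<forall>(g :: real^'n \<Rightarrow> real) A x z. g \<in> borel_measurable borel \<longrightarrow> A \<ge> 0 \<longrightarrow>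
       (\<integral>\<^sup>+ y. ennreal (\<bar>g y\<bar> powr p) \<partial>lborel) \<le> ennreal A \<longrightarrow>
       (\<integral>\<^sup>+ y. ennreal \<bar>g y * (newton_kernel (x - y) - newton_kernel (z - y))\<bar> \<partial>lborel)
         \<le> ennreal (C * norm (x - z) powr (2 - ?N / p) * A powr (1 / p))"
      by (elim exE conjE)
    have "((\<forall>x. I2_tilde_defined f x) \<and> distributional_poisson_solution (I2_tilde f) f) \<and>
      (\<forall>x z. \<bar>I2_tilde f x - I2_tilde f z\<bar> \<le> ?\<kappa> * (C * norm (x - z) powr (2 - ?N / p) * Lp_norm p f))"
      if f: "f \<in> Lp p" for f :: "real^'n \<Rightarrow> real"
    proof -
      obtain g where g: "g \<in> borel_measurable borel" and ae: "AE y in lborel. f y = g y"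
        using Lp_borel_representative[OF f] .
      have fm: "f \<in> borel_measurable lebesgue" using f by (simp add: Lp_def)
      define m where "m = (\<lambda>x z :: real^'n. C * norm (x - z) powr (2 - ?N / p) * Lp_norm p f)"
      have bound: "(\<integral>\<^sup>+ y. ennreal \<bar>g y * (newton_kernel (x - y) - newton_kernel (z - y))\<bar> \<partial>lborel) \<le> ennreal (m x z)" for x z
        unfolding m_def Lp_norm_def using Lp_nn_integral[OF f ae] by (intro C[rule_format] g) auto
      have m: "m x z \<ge> 0" for x z using \<open>C \<ge> 0\<close> by (simp add: m_def Lp_norm_def)
      have loc: "\<exists>M. \<forall>x. norm x \<le> r \<longrightarrow> m x 0 \<le> M" for r
      proof (intro exI allI impI)
        fix x :: "real^'n" assume "norm x \<le> r"
        \<comment> \<open>Monotonicity of the power needs a nonnegative exponent, which p > N/2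
          provides.\<close>
        then show "m x 0 \<le> C * r powr (2 - ?N / p) * Lp_norm p f"
          unfolding m_def using \<open>C \<ge> 0\<close> assms p
          by (intro mult_right_mono mult_left_mono powr_mono2) (auto simp: Lp_norm_def field_simps)
      qed
      show ?thesis
        using I2_tilde_poisson[OF assms(1) g fm ae Lp_locally_integrable[OF f p] bound m loc]
          I2_tilde_regularity[OF assms(1) g fm ae bound m] by (simp add: m_def)
    qed
    note main = this
    show ?thesis
      by (rule exI[of _ C], rule conjI[OF \<open>C \<ge> 0\<close>], rule allI, rule impI, rule main)
  qed
  have log_Lipschitz: "\<exists>C\<ge>0. \<forall>f :: real^'n \<Rightarrow> real. f \<in> Lp ?N \<inter> Lp q \<longrightarrow>
      ((\<forall>x. I2_tilde_defined f x) \<and> distributional_poisson_solution (I2_tilde f) f) \<and>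
      (\<forall>x z. \<bar>I2_tilde f x - I2_tilde f z\<bar> \<le> ?\<kappa> * (C * norm (x - z) * (\<bar>ln (norm (x - z))\<bar> + 1) powr ?e
        * (Lp_norm ?N f + Lp_norm q f)))"
    if q: "1 < q" "q < ?N" for q
  proof -
    have "\<exists>C\<ge>0. \<forall>(g :: real^'n \<Rightarrow> real) A B x z. g \<in> borel_measurable borel \<longrightarrow> A \<ge> 0 \<longrightarrow> B \<ge> 0 \<longrightarrow>
       (\<integral>\<^sup>+ y. ennreal (\<bar>g y\<bar> powr ?N) \<partial>lborel) \<le> ennreal A \<longrightarrow>
       (\<integral>\<^sup>+ y. ennreal (\<bar>g y\<bar> powr q) \<partial>lborel) \<le> ennreal B \<longrightarrow>
       (\<integral>\<^sup>+ y. ennreal \<bar>g y * (newton_kernel (x - y) - newton_kernel (z - y))\<bar> \<partial>lborel)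
         \<le> ennreal (C * norm (x - z) * (\<bar>ln (norm (x - z))\<bar> + 1) powr ?e * (A powr (1 / ?N) + B powr (1 / q)))"
      using newton_kernel_potential_log_Lipschitz_estimate[where 'a="real^'n" and r = q, OF D q(1)] q(2)
      by (simp only: DIM_cart DIM_real mult_1_right)
    then obtain C where "C \<ge> 0" and C: "\<forall>(g :: real^'n \<Rightarrow> real) A B x z. g \<in> borel_measurable borel \<longrightarrow> A \<ge> 0 \<longrightarrow> B \<ge> 0 \<longrightarrow>
       (\<integral>\<^sup>+ y. ennreal (\<bar>g y\<bar> powr ?N) \<partial>lborel) \<le> ennreal A \<longrightarrow>
       (\<integral>\<^sup>+ y. ennreal (\<bar>g y\<bar> powr q) \<partial>lborel) \<le> ennreal B \<longrightarrow>
       (\<integral>\<^sup>+ y. ennreal \<bar>g y * (newton_kernel (x - y) - newton_kernel (z - y))\<bar> \<partial>lborel)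
         \<le> ennreal (C * norm (x - z) * (\<bar>ln (norm (x - z))\<bar> + 1) powr ?e * (A powr (1 / ?N) + B powr (1 / q)))"
      by (elim exE conjE)
    have "((\<forall>x. I2_tilde_defined f x) \<and> distributional_poisson_solution (I2_tilde f) f) \<and>
      (\<forall>x z. \<bar>I2_tilde f x - I2_tilde f z\<bar> \<le> ?\<kappa> * (C * norm (x - z) * (\<bar>ln (norm (x - z))\<bar> + 1) powr ?e
        * (Lp_norm ?N f + Lp_norm q f)))"
      if "f \<in> Lp ?N \<inter> Lp q" for f :: "real^'n \<Rightarrow> real"
    proof -
      have f: "f \<in> Lp ?N" and fq: "f \<in> Lp q" using that by auto
      obtain g where g: "g \<in> borel_measurable borel" and ae: "AE y in lborel. f y = g y"
        using Lp_borel_representative[OF f] .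
      have fm: "f \<in> borel_measurable lebesgue" using f by (simp add: Lp_def)
      define L where "L = Lp_norm ?N f + Lp_norm q f"
      have "L \<ge> 0" by (simp add: L_def Lp_norm_def)
      define m where "m = (\<lambda>x z :: real^'n. C * norm (x - z) * (\<bar>ln (norm (x - z))\<bar> + 1) powr ?e * L)"
      have bound: "(\<integral>\<^sup>+ y. ennreal \<bar>g y * (newton_kernel (x - y) - newton_kernel (z - y))\<bar> \<partial>lborel) \<le> ennreal (m x z)" for x z
        unfolding m_def L_def Lp_norm_def using Lp_nn_integral[OF f ae] Lp_nn_integral[OF fq ae] by (intro C[rule_format] g) auto
      have m: "m x z \<ge> 0" for x z using \<open>C \<ge> 0\<close> \<open>L \<ge> 0\<close> by (simp add: m_def)
      have loc: "\<exists>M. \<forall>x. norm x \<le> r \<longrightarrow> m x 0 \<le> M" for r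
      proof (intro exI allI impI)
        fix x :: "real^'n" assume "norm x \<le> r"
        then have "norm x * (\<bar>ln (norm x)\<bar> + 1) powr ?e \<le> 1 + r + r\<^sup>2"
          using e by (intro log_Lipschitz_modulus_le) auto
        then have "C * (norm x * (\<bar>ln (norm x)\<bar> + 1) powr ?e) * L \<le> C * (1 + r + r\<^sup>2) * L"
          using \<open>C \<ge> 0\<close> \<open>L \<ge> 0\<close> by (intro mult_right_mono mult_left_mono)
        then show "m x 0 \<le> C * (1 + r + r\<^sup>2) * L" by (simp add: m_def mult.assoc)
      qed
      have "?N \<ge> 1" using assms by linarith
      then show ?thesis
        using I2_tilde_poisson[OF assms(1) g fm ae Lp_locally_integrable[OF f] bound m loc]
          I2_tilde_regularity[OF assms(1) g fm ae bound m] by (simp add: m_def L_def)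
    qed
    note main = this
    show ?thesis
      by (rule exI[of _ C], rule conjI[OF \<open>C \<ge> 0\<close>], rule allI, rule impI, rule main)
  qed
  show ?thesis
  proof (intro conjI allI impI)
    fix f :: "real^'n \<Rightarrow> real"
    assume "(p < ?N \<and> f \<in> Lp p) \<or> (p = ?N \<and> (\<exists>q. 1 < q \<and> q < ?N \<and> f \<in> Lp ?N \<inter> Lp q))"
    then have sol: "(\<forall>x. I2_tilde_defined f x) \<and> distributional_poisson_solution (I2_tilde f) f"
      using Holder log_Lipschitz by blast
    then show "distributional_poisson_solution (I2_tilde f) f" ..
    show "I2_tilde_defined f x" for x using sol by blast
  next
    assume "p < ?N"
    from Holder[OF this] obtain C where C: "\<forall>f :: real^'n \<Rightarrow> real. f \<in> Lp p \<longrightarrow>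
      ((\<forall>x. I2_tilde_defined f x) \<and> distributional_poisson_solution (I2_tilde f) f) \<and>
      (\<forall>x z. \<bar>I2_tilde f x - I2_tilde f z\<bar> \<le> ?\<kappa> * (C * norm (x - z) powr (2 - ?N / p) * Lp_norm p f))"
      by blast
    show "\<exists>C. \<forall>f :: real^'n \<Rightarrow> real. f \<in> Lp p \<longrightarrow>
           (\<forall>x z. \<bar>I2_tilde f x - I2_tilde f z\<bar> \<le> C * norm (x - z) powr (2 - ?N / p) * Lp_norm p f)"
      using C by (intro exI[of _ "?\<kappa> * C"]) (simp only: mult.assoc, blast)
  next
    fix q assume "1 < q \<and> q < ?N"
    then obtain C where C: "\<forall>f :: real^'n \<Rightarrow> real. f \<in> Lp ?N \<inter> Lp q \<longrightarrow>
      ((\<forall>x. I2_tilde_defined f x) \<and> distributional_poisson_solution (I2_tilde f) f) \<and>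
      (\<forall>x z. \<bar>I2_tilde f x - I2_tilde f z\<bar> \<le> ?\<kappa> * (C * norm (x - z) * (\<bar>ln (norm (x - z))\<bar> + 1) powr ?e
        * (Lp_norm ?N f + Lp_norm q f)))"
      using log_Lipschitz by blast
    show "\<exists>C. \<forall>f :: real^'n \<Rightarrow> real. f \<in> Lp ?N \<inter> Lp q \<longrightarrow>
       (\<forall>x z. \<bar>I2_tilde f x - I2_tilde f z\<bar> \<le> C * norm (x - z) * (\<bar>ln (norm (x - z))\<bar> + 1) powr ?e
          * (Lp_norm ?N f + Lp_norm q f))"
      using C by (intro exI[of _ "?\<kappa> * C"]) (simp only: mult.assoc, blast)
  qed
qed

end
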